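(* For $|q|<1$, with all sums over $i,j,k\in\mathbb{Z}_{\ge0}$, \begin{align*} \sum_{i,j,k\geq 0}\frac{q^{i^2+\frac{1}{2}j^2+\frac{1}{2}k^2+ij-ik-\frac{1}{2}j-\frac{1}{2}k}}{(q;q)_i(q;q)_j(q;q)_k}&=6\frac{J_2^3}{J_1^3}, \\ \sum_{i,j,k\geq 0} \frac{q^{2i^2+j^2+k^2+2ij-2ik+k}}{(q^2;q^2)_i(q^2;q^2)_j(q^2;q^2)_k}&=\frac{J_3^2J_4}{J_1J_2J_6}, \\ \sum_{i,j,k\geq 0}\frac{q^{2i^2+j^2+k^2+2ij-2ik+j}}{(q^2;q^2)_i(q^2;q^2)_j(q^2;q^2)_k}&=\frac{J_2^2J_3^2}{J_1^2J_4J_6}, \\ \sum_{i,j,k\geq 0}\frac{q^{2i^2+j^2+k^2+2ij-2ik+2i+j}}{(q^2;q^2)_i(q^2;q^2)_j(q^2;q^2)_k}&=\frac{J_2J_6^2}{J_1J_3J_4}, \\ \sum_{i,j,k\geq 0} \frac{q^{2i^2+j^2+k^2+2ij-2ik+2i+2j-k}}{(q^2;q^2)_i(q^2;q^2)_j(q^2;q^2)_k}&=2\frac{J_4J_6^2}{J_2^2J_3}. \end{align*}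
   Context: For $|q|<1$: $(a;q)_n=\prod_{k=0}^{n-1}(1-aq^k)$ ($(a;q)_0=1$), $(a;q)_\infty=\prod_{k\ge0}(1-aq^k)$, and $J_m:=(q^m;q^m)_\infty$. Half-integer powers $q^{x/2}$ are defined via a fixed branch $q^{1/2}$ (e.g. $0<q<1$ with positive root). *)

theory Defs
  imports "HOL-Analysis.Analysis"
begin

definition qpoch :: "complex \<Rightarrow> complex \<Rightarrow> nat \<Rightarrow> complex" where
  "qpoch a q n = (\<Prod>k<n. 1 - a * q ^ k)"

definition qpoch_inf :: "complex \<Rightarrow> complex \<Rightarrow> complex" where
  "qpoch_inf a q = (\<Prod>k. 1 - a * q ^ k)"

definition J :: "nat \<Rightarrow> complex \<Rightarrow> complex" where
  "J m q = qpoch_inf (q ^ m) (q ^ m)"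

end

theory Submission
  imports Defs
begin

text \<open>
  Summing over \<open>j\<close> and \<open>k\<close> by Euler's identity turns each triple sum, in base \<open>p\<close>, into the single series
  \<open>\<Sum>\<^sub>i U\<^sup>i p\<^bsup>i(i-1)/2\<^esup> \<Prod>\<^sub>m\<^sub>=\<^sub>1\<^sup>i (W + p\<^sup>m) / ((p; p)\<^sub>i (-V; p)\<^sub>i)\<close> times an infinite product. For the first
  identity this is again Euler's sum. In the other four it is the left-hand side of Bailey's lemma
  (with one parameter sent to infinity) at \<open>a = U\<close> for the Bailey pair \<open>\<beta>\<^sub>n = 1 / ((p; p)\<^sub>n (-V; p)\<^sub>n)\<close>;
  the right-hand side is \<open>\<Sum>\<^sub>r (-1)\<^sup>r q\<^bsup>3r\<^sup>2\<^esup>\<close> or \<open>\<Sum>\<^sub>r (-1)\<^sup>r q\<^bsup>3r\<^sup>2+2r\<^esup>\<close> over all integers \<open>r\<close>, which the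
  Jacobi triple product evaluates.
\<close>

subsection \<open>Triangular numbers\<close>

text \<open>All five exponents share the form i^2 + ij - ik + j(j-1)/2 + k(k-1)/2; what remains is
  linear and goes into U, V, W. The first sum has p = q and U = V = W = 1; the others have p = q^2
  and (U, V, W) = (1, q, q^2), (1, q^2, q), (q^2, q^2, q), (q^2, q^3, 1). The obstacle is the term
  -ik: the sum over k is Euler's sum at W/p^i, which grows with i. Splitting i factors off its
  product costs p^(-i(i+1)/2), which leaves p^(i(i-1)/2) of p^(i^2) and creates the factors W + p^m.
  In Bailey's lemma the remaining free parameter rho enters through y = ap/rho; the choice a = U, y
  = -UW gives y - a p^m = -U (W + p^m), which is exactly this product. In the four cases treated so,
  the quotients of shifted factorials collapse to at most one factor, and that one cancels against
  \<open>\<alpha>\<close>. The first sum has V = UW = 1, outside the range |V| < 1, |UW| < 1 of this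
  argument. The value q = 0 is separate because negative powers of q occur throughout.\<close>

lemma choose_two_Suc: "Suc n choose 2 = n + (n choose 2)"
  by (simp add: numeral_2_eq_2)

lemma choose_two_0 [simp]: "0 choose 2 = 0"
  by (simp add: numeral_2_eq_2)

lemma choose_two_1 [simp]: "Suc 0 choose 2 = 0"
  by (simp add: numeral_2_eq_2)

lemma choose_two_add: "(m + n) choose 2 = (m choose 2) + (n choose 2) + m * n"
  by (induction m) (auto simp: choose_two_Suc)

text \<open>Division-free form of n(n-1)/2, used wherever a triangular exponent is traded for a
  square.\<close>

lemma choose_two_square: "2 * (n choose 2) + n = n * n"
  by (induction n) (auto simp: choose_two_Suc algebra_simps)

subsection \<open>Finite and infinite \<open>q\<close>-shifted factorials\<close>

lemma qpoch_0 [simp]: "qpoch a q 0 = 1"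
  by (simp add: qpoch_def)

lemma qpoch_Suc: "qpoch a q (Suc n) = qpoch a q n * (1 - a * q ^ n)"
  by (simp add: qpoch_def)

lemma qpoch_Suc_shift: "qpoch a q (Suc n) = (1 - a) * qpoch (a * q) q n"
  unfolding qpoch_def by (subst prod.lessThan_Suc_shift) (simp add: power_Suc2 mult_ac)

lemma qpoch_add: "qpoch a q (m + n) = qpoch a q m * qpoch (a * q ^ m) q n"
  by (induction n) (simp_all add: qpoch_Suc power_add mult_ac)

lemma qpoch_zero [simp]: "qpoch 0 q n = 1"
  by (simp add: qpoch_def)

lemma norm_mult_power_less_1:
  fixes a q :: complex
  assumes "norm q < 1" "norm a < 1"
  shows "norm (a * q ^ k) < 1"
proof -
  have "norm (a * q ^ k) \<le> norm a * 1"
    unfolding norm_mult norm_power using assms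
    by (intro mult_left_mono power_le_one) auto
  then show ?thesis using assms by simp
qed

lemma one_minus_nonzero:
  fixes z :: complex
  assumes "norm z < 1"
  shows "1 - z \<noteq> 0"
  using assms by auto

lemma qpoch_factor_nonzero:
  fixes a q :: complex
  assumes "norm q < 1" "norm a < 1"
  shows "1 - a * q ^ k \<noteq> 0"
  using norm_mult_power_less_1[OF assms] one_minus_nonzero by blast

lemma qpoch_nonzero:
  assumes "norm q < 1" "norm a < 1"
  shows "qpoch a q n \<noteq> 0"
  using qpoch_factor_nonzero[OF assms] by (simp add: qpoch_def)

lemma convergent_qpoch_factors:
  fixes a q :: complex
  assumes "norm q < 1"
  shows "convergent_prod (\<lambda>k. 1 - a * q ^ k)"
proof -
  have "summable (\<lambda>k. norm (1 - a * q ^ k - 1))"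
    using assms by (auto simp: norm_mult norm_power intro!: summable_mult summable_geometric)
  then show ?thesis
    by (intro abs_convergent_prod_imp_convergent_prod summable_imp_abs_convergent_prod)
qed

lemma qpoch_tendsto:
  assumes "norm q < 1"
  shows "(\<lambda>n. qpoch a q n) \<longlonglongrightarrow> qpoch_inf a q"
proof -
  have "(\<lambda>n. qpoch a q (Suc n)) \<longlonglongrightarrow> qpoch_inf a q"
    using convergent_prod_LIMSEQ[OF convergent_qpoch_factors[OF assms, of a]]
    unfolding qpoch_def qpoch_inf_def by (simp add: lessThan_Suc_atMost)
  then show ?thesis by (simp add: filterlim_sequentially_Suc)
qed

lemma qpoch_inf_nonzero:
  assumes "norm q < 1" "norm a < 1"
  shows "qpoch_inf a q \<noteq> 0"
  unfolding qpoch_inf_def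
  using prodinf_nonzero[OF convergent_qpoch_factors[OF assms(1)]] qpoch_factor_nonzero[OF assms]
  by blast

lemma qpoch_inf_shift:
  assumes "norm q < 1"
  shows "qpoch_inf a q = qpoch a q n * qpoch_inf (a * q ^ n) q"
proof (rule LIMSEQ_unique)
  show "(\<lambda>m. qpoch a q (n + m)) \<longlonglongrightarrow> qpoch_inf a q"
    using LIMSEQ_ignore_initial_segment[OF qpoch_tendsto[OF assms, of a], of n]
    by (simp add: add.commute)
  show "(\<lambda>m. qpoch a q (n + m)) \<longlonglongrightarrow> qpoch a q n * qpoch_inf (a * q ^ n) q"
    unfolding qpoch_add by (intro tendsto_intros qpoch_tendsto assms)
qed

lemma qpoch_inf_shift_1:
  assumes "norm q < 1"
  shows "qpoch_inf a q = (1 - a) * qpoch_inf (a * q) q"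
  using qpoch_inf_shift[OF assms, of a 1] by (simp add: qpoch_def)

lemma qpoch_inf_zero [simp]: "qpoch_inf 0 q = 1"
  by (simp add: qpoch_inf_def)

lemma qpoch_bounded:
  assumes "norm q < 1"
  obtains K where "K > 0" "\<And>n. norm (qpoch a q n) \<le> K"
  using convergent_imp_Bseq[OF convergentI[OF qpoch_tendsto[OF assms, of a]]]
  unfolding Bseq_def by blast

lemma inverse_qpoch_bounded:
  assumes "norm q < 1" "norm a < 1"
  obtains K where "K > 0" "\<And>n. norm (inverse (qpoch a q n)) \<le> K"
proof -
  have "(\<lambda>n. inverse (qpoch a q n)) \<longlonglongrightarrow> inverse (qpoch_inf a q)"
    by (intro tendsto_intros qpoch_tendsto qpoch_inf_nonzero assms)
  from convergent_imp_Bseq[OF convergentI[OF this]] show ?thesis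
    unfolding Bseq_def using that by blast
qed

lemma qpoch_inf_mult_uminus:
  assumes "norm q < 1"
  shows "qpoch_inf a q * qpoch_inf (- a) q = qpoch_inf (a ^ 2) (q ^ 2)"
proof (rule LIMSEQ_unique)
  show "(\<lambda>n. qpoch a q n * qpoch (- a) q n) \<longlonglongrightarrow> qpoch_inf a q * qpoch_inf (- a) q"
    by (intro tendsto_intros qpoch_tendsto assms)
  have "qpoch a q n * qpoch (- a) q n = qpoch (a ^ 2) (q ^ 2) n" for n
    unfolding qpoch_def prod.distrib [symmetric]
    by (intro prod.cong refl) (simp add: algebra_simps power2_eq_square power_mult_distrib)
  then show "(\<lambda>n. qpoch a q n * qpoch (- a) q n) \<longlonglongrightarrow> qpoch_inf (a ^ 2) (q ^ 2)"
    using qpoch_tendsto[of "q ^ 2" "a ^ 2"] assms by (simp add: norm_power power_less_one_iff)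
qed

text \<open>The first \<open>n * m\<close> factors are sorted by the residue of their exponent mod
  \<open>m\<close>. Taking the limit along multiples of \<open>m\<close> avoids rearranging an
  infinite product.\<close>

lemma qpoch_inf_split:
  assumes "norm q < 1" "m > 0"
  shows "qpoch_inf a q = (\<Prod>j<m. qpoch_inf (a * q ^ j) (q ^ m))"
proof (rule LIMSEQ_unique)
  have qm: "norm (q ^ m) < 1"
    using assms by (simp add: norm_power power_less_one_iff)
  show "(\<lambda>n. \<Prod>j<m. qpoch (a * q ^ j) (q ^ m) n) \<longlonglongrightarrow> (\<Prod>j<m. qpoch_inf (a * q ^ j) (q ^ m))"
    by (intro tendsto_intros qpoch_tendsto qm)
  have "(\<Prod>j<m. qpoch (a * q ^ j) (q ^ m) n) = qpoch a q (n * m)" for n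
  proof (induction n)
    case (Suc n)
    have "qpoch a q (Suc n * m) = qpoch a q (n * m) * qpoch (a * q ^ (n * m)) q m"
      by (simp add: qpoch_add [symmetric] add.commute)
    also have "qpoch (a * q ^ (n * m)) q m = (\<Prod>j<m. 1 - a * q ^ j * (q ^ m) ^ n)"
      unfolding qpoch_def by (intro prod.cong refl) (simp add: power_mult [symmetric] mult_ac)
    finally show ?case
      by (simp add: qpoch_Suc prod.distrib Suc.IH)
  qed simp
  moreover have "filterlim (\<lambda>n. n * m) at_top sequentially"
    using assms(2) by (intro filterlim_subseq) (auto simp: strict_mono_def)
  ultimately show "(\<lambda>n. \<Prod>j<m. qpoch (a * q ^ j) (q ^ m) n) \<longlonglongrightarrow> qpoch_inf a q"
    using filterlim_compose[OF qpoch_tendsto[OF assms(1), of a]] by simp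
qed

subsection \<open>The \<open>1\<phi>1\<close> summation\<close>

lemma summable_power_choose_two:
  fixes q c :: real
  assumes "0 \<le> q" "q < 1" 
  shows "summable (\<lambda>n. q ^ (n choose 2) * c ^ n)"
proof -
  have "(\<lambda>n. norm (q ^ n * c)) \<longlonglongrightarrow> 0"
    using assms by (intro tendsto_norm_zero tendsto_mult_left_zero LIMSEQ_power_zero) auto
  then have "eventually (\<lambda>n. norm (q ^ n * c) < 1/2) sequentially"
    by (rule order_tendstoD) simp
  then obtain N where N: "\<And>n. n \<ge> N \<Longrightarrow> norm (q ^ n * c) < 1/2"
    unfolding eventually_sequentially by blast
  show ?thesis
  proof (rule summable_ratio_test[where c = "1/2" and N = N])
    fix n assume "n \<ge> N"
    have "norm (q ^ (Suc n choose 2) * c ^ Suc n) = norm (q ^ n * c) * norm (q ^ (n choose 2) * c ^ n)"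
      by (simp add: choose_two_Suc power_add abs_mult)
    also have "\<dots> \<le> 1/2 * norm (q ^ (n choose 2) * c ^ n)"
      using N[OF \<open>n \<ge> N\<close>] by (intro mult_right_mono) auto
    finally show "norm (q ^ (Suc n choose 2) * c ^ Suc n) \<le> 1/2 * norm (q ^ (n choose 2) * c ^ n)" .
  qed simp
qed

lemma prod_scaled_diff:
  fixes z :: "'a::comm_ring_1"
  shows "(\<Prod>k<m. z * d - c * d * q ^ k) = d ^ m * (\<Prod>k<m. z - c * q ^ k)"
  by (induction m) (simp_all add: algebra_simps)

text \<open>In the usual notation \<open>(C/z; q)\<^sub>m z\<^sup>m\<close> is the product \<open>\<Prod>k<m. z - C q\<^sup>k\<close>, which makes sense
  for \<open>z = 0\<close> as well.\<close>

definition phi11_term :: "complex \<Rightarrow> complex \<Rightarrow> complex \<Rightarrow> nat \<Rightarrow> complex" where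
  "phi11_term q z c m =
     (-1) ^ m * q ^ (m choose 2) * (\<Prod>k<m. z - c * q ^ k) / (qpoch q q m * qpoch c q m)"

text \<open>The bound is uniform in the shift \<open>n\<close>. Scaling \<open>z\<close> and
  \<open>c\<close> by \<open>q ^ n\<close> pulls \<open>q ^ (n * m)\<close> out of the numerator,
  while the denominator stays away from 0 because it is a quotient of values of the single sequence
  \<open>qpoch c q\<close>. The case \<open>n = 0\<close> gives summability, large \<open>n\<close>
  gives the majorant for a limit under the sum.\<close>

lemma phi11_term_bound:
  assumes "norm q < 1" "norm c < 1"
  obtains K where "K > 0"
    "\<And>m n. norm (phi11_term q (z * q ^ n) (c * q ^ n) m)
       \<le> K * (norm q ^ (m choose 2) * (norm z + norm c) ^ m) * norm q ^ (n * m)"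
proof -
  obtain K1 where K1: "K1 > 0" "\<And>n. norm (inverse (qpoch q q n)) \<le> K1"
    using inverse_qpoch_bounded[OF assms(1) assms(1)] by blast
  obtain K2 where K2: "K2 > 0" "\<And>n. norm (inverse (qpoch c q n)) \<le> K2"
    using inverse_qpoch_bounded[OF assms(1) assms(2)] by blast
  obtain K3 where K3: "K3 > 0" "\<And>n. norm (qpoch c q n) \<le> K3"
    using qpoch_bounded[OF assms(1)] by blast
  have "norm (phi11_term q (z * q ^ n) (c * q ^ n) m)
      \<le> (K1 * (K3 * K2)) * (norm q ^ (m choose 2) * (norm z + norm c) ^ m) * norm q ^ (n * m)" for m n
  proof -
    have prod_eq: "(\<Prod>k<m. z * q ^ n - c * q ^ n * q ^ k) = q ^ (n * m) * (\<Prod>k<m. z - c * q ^ k)"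
      using prod_scaled_diff[of z "q ^ n" c q m] by (simp add: power_mult)
    have "norm (\<Prod>k<m. z - c * q ^ k) \<le> (\<Prod>k<m. norm z + norm c)"
      unfolding prod_norm [symmetric]
    proof (intro prod_mono conjI norm_ge_zero)
      fix k
      have "norm (c * q ^ k) \<le> norm c * 1"
        unfolding norm_mult norm_power using assms by (intro mult_left_mono power_le_one) auto
      then show "norm (z - c * q ^ k) \<le> norm z + norm c"
        using norm_triangle_ineq4[of z "c * q ^ k"] by simp
    qed
    then have prod_le: "norm (\<Prod>k<m. z - c * q ^ k) \<le> (norm z + norm c) ^ m" by simp
    have "inverse (qpoch (c * q ^ n) q m) = qpoch c q n * inverse (qpoch c q (n + m))"
      using qpoch_nonzero[OF assms] by (simp add: qpoch_add)
    then have "norm (inverse (qpoch (c * q ^ n) q m)) \<le> K3 * K2"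
      using K1 K2 K3 by (auto simp: norm_mult intro!: mult_mono)
    then have "norm (inverse (qpoch q q m)) * norm (inverse (qpoch (c * q ^ n) q m)) \<le> K1 * (K3 * K2)"
      using K1 K2 K3 by (intro mult_mono) auto
    then have "(norm (inverse (qpoch q q m)) * norm (inverse (qpoch (c * q ^ n) q m)))
       * (norm q ^ (m choose 2) * norm (\<Prod>k<m. z - c * q ^ k) * norm q ^ (n * m))
       \<le> (K1 * (K3 * K2)) * (norm q ^ (m choose 2) * (norm z + norm c) ^ m * norm q ^ (n * m))"
      by (rule mult_mono) (use prod_le K1 K2 K3 in \<open>auto intro!: mult_left_mono mult_right_mono\<close>)
    then show ?thesis
      unfolding phi11_term_def prod_eq
      by (simp add: norm_mult norm_divide norm_power norm_inverse divide_inverse mult_ac)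
  qed
  then show ?thesis using that[of "K1 * (K3 * K2)"] K1 K2 K3 by simp
qed

lemma phi11_summable_norm:
  assumes "norm q < 1" "norm c < 1"
  shows "summable (\<lambda>m. norm (phi11_term q z c m))"
proof -
  obtain K where K: "\<And>m n. norm (phi11_term q (z * q ^ n) (c * q ^ n) m)
       \<le> K * (norm q ^ (m choose 2) * (norm z + norm c) ^ m) * norm q ^ (n * m)"
    using phi11_term_bound[OF assms] by blast
  show ?thesis
    using K[of 0] assms
    by (intro summable_comparison_test'[OF summable_mult[OF summable_power_choose_two[of "norm q"]]]) auto
qed

text \<open>The terms of the two sides differ by \<open>G (Suc m) - G m\<close>, where the
  certificate \<open>G\<close> is a simple multiple of the term itself. The sum telescopes to 0: the
  factor \<open>1 - q ^ m\<close> makes \<open>G 0\<close> vanish, and \<open>G\<close> tends to 0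
  with the terms.\<close>

lemma phi11_contiguous:
  assumes "norm q < 1" "norm c < 1"
  shows "(1 - c) * (\<Sum>m. phi11_term q z c m) = (1 - z) * (\<Sum>m. phi11_term q (z * q) (c * q) m)"
proof -
  note summ = summable_norm_cancel[OF phi11_summable_norm[OF assms(1)]]
  have cq: "norm (c * q) < 1" using norm_mult_power_less_1[OF assms, of 1] by simp
  define t where "t = phi11_term q z c"
  define G where "G m = - (1 - q ^ m) * t m * (1 - c)" for m
  have step: "(1 - c) * t m - (1 - z) * phi11_term q (z * q) (c * q) m = G (Suc m) - G m" for m
  proof -
    have nz: "1 - q ^ Suc m \<noteq> 0" "1 - c * q ^ m \<noteq> 0" "qpoch c q m \<noteq> 0" "qpoch q q m \<noteq> 0" "1 - c \<noteq> 0"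
      using qpoch_factor_nonzero[OF assms(1) assms(1), of m] qpoch_factor_nonzero[OF assms, of m]
        qpoch_nonzero[OF assms] qpoch_nonzero[OF assms(1) assms(1)] qpoch_factor_nonzero[OF assms, of 0]
      by auto
    \<comment> \<open>The ratio of consecutive terms, cleared of denominators; it is the only fact
      about \<open>t (Suc m)\<close> that the telescoping needs.\<close>
    have 1: "(1 - q ^ Suc m) * (1 - c * q ^ m) * t (Suc m) = - (q ^ m * (z - c * q ^ m) * t m)"
    proof -
      have "qpoch q q (Suc m) * qpoch c q (Suc m)
          = (1 - q ^ Suc m) * (1 - c * q ^ m) * (qpoch q q m * qpoch c q m)"
        by (simp add: qpoch_Suc mult_ac)
      then have "t (Suc m) = - (q ^ m * (z - c * q ^ m) * t m) / ((1 - q ^ Suc m) * (1 - c * q ^ m))"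
        unfolding t_def phi11_term_def choose_two_Suc power_add by (simp add: mult_ac)
      then show ?thesis using nz by simp
    qed
    have "(1 - c) * qpoch (c * q) q m = qpoch c q m * (1 - c * q ^ m)"
      using qpoch_Suc_shift[of c q m] qpoch_Suc[of c q m] by simp
    then have qc: "qpoch (c * q) q m = qpoch c q m * (1 - c * q ^ m) / (1 - c)"
      using nz by (simp add: field_simps)
    have "(\<Prod>k<m. z * q - c * q * q ^ k) = q ^ m * (\<Prod>k<m. z - c * q ^ k)"
      by (rule prod_scaled_diff)
    then have 2: "(1 - c * q ^ m) * phi11_term q (z * q) (c * q) m = (1 - c) * q ^ m * t m"
      using nz unfolding t_def phi11_term_def qc by (simp add: field_simps)
    have "(1 - c * q ^ m) * ((1 - c) * t m - (1 - z) * phi11_term q (z * q) (c * q) m)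
        = (1 - c) * (1 - c * q ^ m) * t m - (1 - z) * ((1 - c) * q ^ m * t m)"
      unfolding 2 [symmetric] by (simp add: algebra_simps)
    also have "\<dots> = (1 - c) * (q ^ m * (z - c * q ^ m) * t m) + (1 - c * q ^ m) * (1 - q ^ m) * t m * (1 - c)"
      by (simp add: algebra_simps)
    also have "q ^ m * (z - c * q ^ m) * t m = - ((1 - q ^ Suc m) * (1 - c * q ^ m) * t (Suc m))"
      using 1 by simp
    also have "(1 - c) * - ((1 - q ^ Suc m) * (1 - c * q ^ m) * t (Suc m))
        + (1 - c * q ^ m) * (1 - q ^ m) * t m * (1 - c) = (1 - c * q ^ m) * (G (Suc m) - G m)"
      unfolding G_def by (simp add: algebra_simps)
    finally show ?thesis using nz by simp
  qed
  have "G \<longlonglongrightarrow> - (1 - 0) * 0 * (1 - c)"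
    unfolding G_def t_def
    by (intro tendsto_intros LIMSEQ_power_zero summable_LIMSEQ_zero summ assms)
  then have "(\<lambda>m. G (Suc m) - G m) sums (0 - G 0)"
    by (intro telescope_sums) simp
  moreover have "(\<lambda>m. G (Suc m) - G m) sums
      ((1 - c) * (\<Sum>m. t m) - (1 - z) * (\<Sum>m. phi11_term q (z * q) (c * q) m))"
    unfolding step [symmetric] t_def
    by (intro sums_diff sums_mult summable_sums summ assms cq)
  ultimately have "0 - G 0 = (1 - c) * (\<Sum>m. t m) - (1 - z) * (\<Sum>m. phi11_term q (z * q) (c * q) m)"
    by (rule sums_unique2)
  then show ?thesis by (simp add: G_def t_def)
qed

text \<open>Iterating the contiguous relation moves \<open>(z, c)\<close> to
  \<open>(z * q ^ n, c * q ^ n)\<close> at the cost of the finite products. As n grows both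
  arguments tend to 0 and only the term m = 0 survives, so the sum tends to 1 and the infinite
  products remain.\<close>

theorem phi11_sums:
  assumes "norm q < 1" "norm c < 1"
  shows "phi11_term q z c sums (qpoch_inf z q / qpoch_inf c q)"
proof -
  define f where "f n = (\<Sum>m. phi11_term q (z * q ^ n) (c * q ^ n) m)" for n
  have iter: "qpoch c q n * f 0 = qpoch z q n * f n" for n
  proof (induction n)
    case (Suc n)
    have "(1 - c * q ^ n) * f n = (1 - z * q ^ n) * f (Suc n)"
      using phi11_contiguous[OF assms(1) norm_mult_power_less_1[OF assms, of n], of "z * q ^ n"]
      by (simp add: f_def mult_ac)
    moreover have "qpoch c q (Suc n) * f 0 = qpoch z q n * ((1 - c * q ^ n) * f n)"
      using Suc.IH by (simp add: qpoch_Suc mult_ac)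
    ultimately show ?case by (simp add: qpoch_Suc mult_ac)
  qed simp
  obtain K where K: "K > 0" "\<And>m n. norm (phi11_term q (z * q ^ n) (c * q ^ n) m)
       \<le> K * (norm q ^ (m choose 2) * (norm z + norm c) ^ m) * norm q ^ (n * m)"
    using phi11_term_bound[OF assms] by blast
  define M where "M m = K * (norm q ^ (m choose 2) * (norm z + norm c) ^ m)" for m
  have M: "M m \<ge> 0" "summable M" for m
    using K(1) assms unfolding M_def by (auto intro!: summable_mult summable_power_choose_two)
  have "f \<longlonglongrightarrow> (\<Sum>m. if m = 0 then 1 else 0 :: complex)"
    unfolding f_def
  proof (rule conjunct2[OF conjunct2[OF tannerys_theorem[where M = M]]])
    show "(\<lambda>n. phi11_term q (z * q ^ n) (c * q ^ n) m) \<longlonglongrightarrow> (if m = 0 then 1 else 0)" for m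
    proof (cases "m = 0")
      case False
      have "(\<lambda>n. M m * (norm q ^ m) ^ n) \<longlonglongrightarrow> M m * 0"
        using False assms
        by (intro tendsto_intros LIMSEQ_power_zero) (auto simp: power_less_one_iff)
      then have "(\<lambda>n. M m * (norm q ^ m) ^ n) \<longlonglongrightarrow> 0" by simp
      then have "(\<lambda>n. phi11_term q (z * q ^ n) (c * q ^ n) m) \<longlonglongrightarrow> 0"
      proof (rule Lim_null_comparison [rotated])
        show "\<forall>\<^sub>F n in sequentially. norm (phi11_term q (z * q ^ n) (c * q ^ n) m) \<le> M m * (norm q ^ m) ^ n"
          unfolding M_def power_mult [symmetric] mult.commute[of m]
          by (intro always_eventually allI K(2))
      qed
      then show ?thesis using False by simp
    qed (simp add: phi11_term_def)
    have "norm (phi11_term q (z * q ^ n) (c * q ^ n) m) \<le> M m" for m n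
    proof -
      have "M m * norm q ^ (n * m) \<le> M m * 1"
        using assms M by (intro mult_left_mono power_le_one) auto
      then show ?thesis using K(2)[of n m] by (simp add: M_def)
    qed
    then show "\<forall>\<^sub>F (m, n) in sequentially \<times>\<^sub>F sequentially.
        norm (phi11_term q (z * q ^ n) (c * q ^ n) m) \<le> M m"
      by (intro always_eventually) auto
  qed (use M in auto)
  moreover have "(\<Sum>m. if m = 0 then 1 else 0 :: complex) = 1"
    using suminf_finite[of "{0::nat}" "\<lambda>m. if m = 0 then 1 else 0 :: complex"] by simp
  ultimately have "f \<longlonglongrightarrow> 1" by simp
  then have "(\<lambda>n. qpoch z q n * f n) \<longlonglongrightarrow> qpoch_inf z q * 1"
    by (intro tendsto_intros qpoch_tendsto assms)
  moreover have "(\<lambda>n. qpoch c q n * f 0) \<longlonglongrightarrow> qpoch_inf c q * f 0"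
    by (intro tendsto_intros qpoch_tendsto assms)
  ultimately have "qpoch_inf c q * f 0 = qpoch_inf z q"
    using LIMSEQ_unique iter by simp
  then have "f 0 = qpoch_inf z q / qpoch_inf c q"
    using qpoch_inf_nonzero[OF assms] by (simp add: field_simps)
  then show ?thesis
    using summable_sums[OF summable_norm_cancel[OF phi11_summable_norm[OF assms, of z]]]
    by (simp add: f_def)
qed

lemma phi11_has_sum:
  assumes "norm q < 1" "norm c < 1"
  shows "(phi11_term q z c has_sum (qpoch_inf z q / qpoch_inf c q)) UNIV"
  by (intro norm_summable_imp_has_sum phi11_summable_norm phi11_sums assms)

corollary euler_has_sum:
  assumes "norm q < 1"
  shows "((\<lambda>n. q ^ (n choose 2) * x ^ n / qpoch q q n) has_sum qpoch_inf (- x) q) UNIV"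
proof -
  have "phi11_term q (- x) 0 = (\<lambda>n. q ^ (n choose 2) * x ^ n / qpoch q q n)"
    by (rule ext) (simp add: phi11_term_def power_minus[of x])
  then show ?thesis using phi11_has_sum[OF assms, of 0 "- x"] by simp
qed

subsection \<open>Bailey pairs\<close>

definition bailey_pair :: "complex \<Rightarrow> complex \<Rightarrow> (nat \<Rightarrow> complex) \<Rightarrow> (nat \<Rightarrow> complex) \<Rightarrow> bool" where
  "bailey_pair a q \<alpha> \<beta> \<longleftrightarrow>
     (\<forall>n. \<beta> n = (\<Sum>r\<le>n. \<alpha> r / (qpoch q q (n - r) * qpoch (a * q) q (n + r))))"

text \<open>The pair with \<open>\<beta>\<^sub>n = 1 / ((q; q)\<^sub>n (cq; q)\<^sub>n)\<close> is the limit of the very well-poised \<open>6\<phi>5\<close> sum in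
  which \<open>c = a/b\<close>. Its \<open>\<alpha>\<close> is characterised by the existence of a companion \<open>\<delta>\<close> that makes the
  first order recurrence of \<open>\<beta>\<close> telescope; both conditions on \<open>\<delta>\<close> together express that the
  telescoping relation, linear in \<open>q\<^sup>n\<close>, holds for all \<open>n\<close>.\<close>

lemma bailey_pair_product:
  assumes q: "norm q < 1" "q \<noteq> 0" and a: "norm (a * q) < 1" and c: "norm (c * q) < 1"
    and zero: "\<alpha> 0 = 1" "\<delta> 0 = 0"
    and rel1: "\<And>r. q ^ r * (\<delta> (Suc r) - \<delta> r) = - \<alpha> r * (1 - (1 + c) * q ^ r + a * (q ^ r) ^ 2)"
    and rel2: "\<And>r. \<delta> (Suc r) - a * (q ^ r) ^ 2 * \<delta> r = \<alpha> r * q ^ r * (c - a)"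
  shows "bailey_pair a q \<alpha> (\<lambda>n. 1 / (qpoch q q n * qpoch (c * q) q n))"
proof -
  define F where "F n = (\<Sum>r\<le>n. \<alpha> r / (qpoch q q (n - r) * qpoch (a * q) q (n + r)))" for n
  have step: "F (Suc n) * ((1 - q ^ Suc n) * (1 - c * q ^ Suc n)) = F n" for n
  proof -
    define D where "D r = 1 / (qpoch q q (Suc n - r) * qpoch (a * q) q (Suc n + r))" for r
    \<comment> \<open>For \<open>r \<le> Suc n\<close> the factor
      \<open>1 - a * q ^ Suc (n + r)\<close> cancels the last factor of \<open>D r\<close>, so
      \<open>H r\<close> is \<open>- (q ^ Suc n) * \<delta> r\<close> over
      \<open>qpoch q q (Suc n - r) * qpoch (a * q) q (n + r)\<close>. The default 0 beyond
      \<open>Suc n\<close> stands for 1/(q; q)_(-1) = 0, which truncated subtraction would not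
      give.\<close>
    define H where "H r = (if r \<le> Suc n then - (q ^ Suc n) * \<delta> r * (1 - a * q ^ Suc (n + r)) * D r else 0)" for r
    have F1: "F (Suc n) = (\<Sum>r\<le>Suc n. \<alpha> r * D r)"
      unfolding F_def D_def by simp
    have "\<alpha> r / (qpoch q q (n - r) * qpoch (a * q) q (n + r))
        = \<alpha> r * D r * ((1 - q ^ (Suc n - r)) * (1 - a * q ^ Suc (n + r)))" if "r \<le> n" for r
      using that qpoch_factor_nonzero[OF q(1) q(1), of "n - r"] qpoch_factor_nonzero[OF q(1) a, of "n + r"]
      by (simp add: D_def Suc_diff_le qpoch_Suc mult_ac)
    then have "F n = (\<Sum>r\<le>n. \<alpha> r * D r * ((1 - q ^ (Suc n - r)) * (1 - a * q ^ Suc (n + r))))"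
      unfolding F_def by (intro sum.cong) auto
    then have F0: "F n = (\<Sum>r\<le>Suc n. \<alpha> r * D r * ((1 - q ^ (Suc n - r)) * (1 - a * q ^ Suc (n + r))))"
      by simp
    have "\<alpha> r * D r * ((1 - q ^ Suc n) * (1 - c * q ^ Suc n))
        - \<alpha> r * D r * ((1 - q ^ (Suc n - r)) * (1 - a * q ^ Suc (n + r))) = H (Suc r) - H r"
      if "r \<le> Suc n" for r
    proof -
      define u where "u = q ^ r"
      define v where "v = q ^ (Suc n - r)"
      have uv: "q ^ Suc n = u * v"
        unfolding u_def v_def using that by (simp add: power_add [symmetric])
      have HS: "H (Suc r) = - (q ^ Suc n) * \<delta> (Suc r) * (1 - v) * D r"
      proof (cases "r \<le> n")
        case True
        then show ?thesis
          using qpoch_factor_nonzero[OF q(1) q(1), of "n - r"]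
            qpoch_factor_nonzero[OF q(1) a, of "Suc (n + r)"]
          by (simp add: H_def D_def v_def Suc_diff_le qpoch_Suc mult_ac)
      next
        case False
        then show ?thesis using that by (simp add: H_def v_def)
      qed
      have u: "u \<noteq> 0" using q by (simp add: u_def)
      have r1: "\<alpha> r * (1 - (1 + c) * u + a * u ^ 2) = - (u * (\<delta> (Suc r) - \<delta> r))"
        and r2: "\<delta> (Suc r) - a * u ^ 2 * \<delta> r = \<alpha> r * u * (c - a)"
        using rel1[of r] rel2[of r] by (simp_all add: u_def)
      \<comment> \<open>With u = q^r and v = q^(n+1-r) both sides are polynomials in v without
        constant term. The coefficients of v match by \<open>rel1\<close>, those of v^2 by
        \<open>rel2\<close>.\<close>
      have "\<alpha> r * ((1 - u * v) * (1 - c * (u * v))) - \<alpha> r * ((1 - v) * (1 - a * (u * v * u)))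
          = v * (\<alpha> r * (1 - (1 + c) * u + a * u ^ 2)) + u * v\<^sup>2 * (\<alpha> r * u * (c - a))"
        by (simp add: algebra_simps power2_eq_square)
      also have "\<dots> = - (u * v) * \<delta> (Suc r) * (1 - v) + u * v * \<delta> r * (1 - a * (u * v * u))"
        unfolding r1 r2 [symmetric] by (simp add: algebra_simps power2_eq_square)
      finally have "\<alpha> r * ((1 - u * v) * (1 - c * (u * v))) - \<alpha> r * ((1 - v) * (1 - a * (u * v * u)))
          = - (u * v) * \<delta> (Suc r) * (1 - v) + u * v * \<delta> r * (1 - a * (u * v * u))" .
      then have E: "(\<alpha> r * ((1 - u * v) * (1 - c * (u * v))) - \<alpha> r * ((1 - v) * (1 - a * (u * v * u)))) * D r
          = (- (u * v) * \<delta> (Suc r) * (1 - v) + u * v * \<delta> r * (1 - a * (u * v * u))) * D r"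
        by (rule arg_cong)
      have uvu: "q ^ Suc (n + r) = u * v * u"
        using uv by (simp add: power_add u_def)
      have Hr: "H r = - (u * v) * \<delta> r * (1 - a * (u * v * u)) * D r"
        using that unfolding H_def uvu uv by simp
      show ?thesis
        unfolding HS Hr uv uvu v_def [symmetric] using E by (simp add: algebra_simps)
    qed
    then have "F (Suc n) * ((1 - q ^ Suc n) * (1 - c * q ^ Suc n)) - F n = (\<Sum>r\<le>Suc n. H (Suc r) - H r)"
      unfolding F0 F1 sum_distrib_right sum_subtractf [symmetric] by (intro sum.cong) auto
    also have "\<dots> = H (Suc (Suc n)) - H 0"
      using sum_lessThan_telescope[of H "Suc (Suc n)"] by (simp only: lessThan_Suc_atMost)
    also have "\<dots> = 0" by (simp add: H_def zero)
    finally show ?thesis by simp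
  qed
  have "F n = 1 / (qpoch q q n * qpoch (c * q) q n)" for n
  proof (induction n)
    case 0
    show ?case by (simp add: F_def zero)
  next
    case (Suc n)
    have nz: "1 - q ^ Suc n \<noteq> 0" "1 - c * q ^ Suc n \<noteq> 0"
      using qpoch_factor_nonzero[OF q(1) q(1), of n] qpoch_factor_nonzero[OF q(1) c, of n]
      by (simp_all add: mult_ac)
    then have "F (Suc n) = F n / ((1 - q ^ Suc n) * (1 - c * q ^ Suc n))"
      unfolding step[of n, symmetric] by simp
    then show ?case by (simp add: Suc.IH qpoch_Suc mult_ac)
  qed
  then show ?thesis by (simp add: bailey_pair_def F_def)
qed

section \<open>The limiting case of Bailey's lemma\<close>

lemma summable_on_product_real:
  fixes f :: "'a \<Rightarrow> real" and g :: "'b \<Rightarrow> real"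
  assumes "f summable_on A" "g summable_on B" "\<And>x. f x \<ge> 0" "\<And>y. g y \<ge> 0"
  shows "(\<lambda>(x, y). f x * g y) summable_on A \<times> B"
proof (rule summable_on_SigmaI)
  show "((\<lambda>y. case (x, y) of (x, y) \<Rightarrow> f x * g y) has_sum f x * infsum g B) B" for x
    using assms by (auto intro!: has_sum_cmult_right)
  show "(\<lambda>x. f x * infsum g B) summable_on A"
    using assms by (intro summable_on_cmult_left)
qed (use assms in auto)

text \<open>Inserting the definition of \<open>\<beta>\<close> and writing n = r + m turns the left
  side into a double series whose sum over m is a 1phi1 at \<open>z = y * q ^ r\<close>,
  \<open>c = a * q * q ^ (2 * r)\<close>, known in closed form. In the usual notation y = aq/rho
  with rho the finite parameter; \<open>y - a * q ^ Suc k\<close> replaces (rho; q)_n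
  (aq/rho)^n.\<close>

theorem bailey_limit:
  assumes q: "norm q < 1" and a: "norm a \<le> 1" and y: "norm y < 1"
    and pair: "bailey_pair a q \<alpha> \<beta>" and bdd: "\<And>r. norm (\<alpha> r) \<le> A"
    and T: "((\<lambda>r. (-1) ^ r * q ^ (r choose 2) * (\<Prod>k<r. y - a * q ^ Suc k) / qpoch y q r * \<alpha> r) has_sum T) UNIV"
  shows "((\<lambda>n. (-1) ^ n * q ^ (n choose 2) * (\<Prod>k<n. y - a * q ^ Suc k) * \<beta> n)
           has_sum (qpoch_inf y q / qpoch_inf (a * q) q * T)) UNIV"
proof -
  have aq: "norm (a * q) < 1"
  proof -
    have "norm a * norm q \<le> 1 * norm q" using a by (intro mult_right_mono) auto
    then show ?thesis using q by (simp add: norm_mult)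
  qed
  define P where "P n = (\<Prod>k<n. y - a * q ^ Suc k)" for n
  define g where "g = (\<lambda>(r, m). (-1) ^ (r + m) * q ^ ((r + m) choose 2) * P (r + m)
      * (\<alpha> r / (qpoch q q m * qpoch (a * q) q (2 * r + m))))"
  define h where "h r = (-1) ^ r * q ^ (r choose 2) * P r * \<alpha> r / qpoch (a * q) q (2 * r)" for r
  have g_eq: "g (r, m) = h r * phi11_term q (y * q ^ r) (a * q * q ^ (2 * r)) m" for r m
  proof -
    have "P (r + m) = P r * (\<Prod>k<m. y - a * q ^ Suc (r + k))"
      unfolding P_def by (induction m) (simp_all add: mult_ac)
    moreover have "(\<Prod>k<m. y * q ^ r - a * q * q ^ (2 * r) * q ^ k) = q ^ (r * m) * (\<Prod>k<m. y - a * q ^ Suc (r + k))"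
      using prod_scaled_diff[of y "q ^ r" "a * q * q ^ r" q m]
      unfolding mult_2 power_mult by (simp add: power_add mult_ac)
    ultimately show ?thesis
      unfolding g_def h_def phi11_term_def
      by (simp add: choose_two_add qpoch_add power_add mult_ac)
  qed
  have inner: "((\<lambda>m. g (r, m)) has_sum (qpoch_inf y q / qpoch_inf (a * q) q
      * ((-1) ^ r * q ^ (r choose 2) * P r / qpoch y q r * \<alpha> r))) UNIV" for r
  proof -
    have "((\<lambda>m. g (r, m)) has_sum h r * (qpoch_inf (y * q ^ r) q / qpoch_inf (a * q * q ^ (2 * r)) q)) UNIV"
      unfolding g_eq by (intro has_sum_cmult_right phi11_has_sum q norm_mult_power_less_1 aq)
    moreover have "h r * (qpoch_inf (y * q ^ r) q / qpoch_inf (a * q * q ^ (2 * r)) q) = qpoch_inf y q / qpoch_inf (a * q) q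
      * ((-1) ^ r * q ^ (r choose 2) * P r / qpoch y q r * \<alpha> r)"
      using qpoch_nonzero[OF q y, of r]
      unfolding h_def qpoch_inf_shift[OF q, of y r] qpoch_inf_shift[OF q, of "a * q" "2 * r"]
      by (simp add: mult_ac)
    ultimately show ?thesis by simp
  qed
  have "g summable_on UNIV \<times> UNIV"
  proof -
    obtain K1 where K1: "K1 > 0" "\<And>n. norm (inverse (qpoch q q n)) \<le> K1"
      using inverse_qpoch_bounded[OF q q] by blast
    obtain K2 where K2: "K2 > 0" "\<And>n. norm (inverse (qpoch (a * q) q n)) \<le> K2"
      using inverse_qpoch_bounded[OF q aq] by blast
    define f where "f n = norm q ^ (n choose 2) * 2 ^ n" for n
    have f: "f summable_on UNIV" "\<And>n. f n \<ge> 0"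
      unfolding f_def using q
      by (auto intro!: summable_nonneg_imp_summable_on summable_power_choose_two)
    have P_le: "norm (P n) \<le> 2 ^ n" for n
    proof -
      have "norm (P n) \<le> (\<Prod>k<n. 2)"
        unfolding P_def prod_norm [symmetric]
      proof (intro prod_mono conjI norm_ge_zero)
        fix k
        have "norm (a * q ^ Suc k) \<le> 1 * 1"
          unfolding norm_mult norm_power using q a by (intro mult_mono power_le_one) auto
        then show "norm (y - a * q ^ Suc k) \<le> 2"
          using norm_triangle_ineq4[of y "a * q ^ Suc k"] y by simp
      qed
      then show ?thesis by simp
    qed
    have A: "A \<ge> 0" using bdd[of 0] norm_ge_zero order_trans by blast
    have "norm (g (r, m)) \<le> A * (K1 * K2) * (f r * f m)" for r m
    proof -
      \<comment> \<open>The triangular number of r + m exceeds the sum of the two triangular numbers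
        by r * m; dropping this cross term leaves a majorant that factors into a function of r and
        one of m.\<close>
      have "norm q ^ ((r + m) choose 2) \<le> norm q ^ (r choose 2) * norm q ^ (m choose 2) * 1"
        unfolding choose_two_add power_add using q by (intro mult_left_mono power_le_one) auto
      then have "norm q ^ ((r + m) choose 2) * norm (P (r + m))
          \<le> norm q ^ (r choose 2) * norm q ^ (m choose 2) * 2 ^ (r + m)"
        using P_le by (intro mult_mono) auto
      then have 1: "norm q ^ ((r + m) choose 2) * norm (P (r + m)) \<le> f r * f m"
        by (simp add: f_def power_add mult_ac)
      have 2: "norm (\<alpha> r) * (norm (inverse (qpoch q q m)) * norm (inverse (qpoch (a * q) q (2 * r + m))))
          \<le> A * (K1 * K2)"
        using K1 K2 A bdd by (intro mult_mono) auto
      have "norm (\<alpha> r) * (norm (inverse (qpoch q q m)) * norm (inverse (qpoch (a * q) q (2 * r + m))))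
          * (norm q ^ ((r + m) choose 2) * norm (P (r + m))) \<le> A * (K1 * K2) * (f r * f m)"
        by (rule mult_mono) (use 1 2 A K1 K2 in auto)
      then show ?thesis
        by (simp add: g_def norm_mult norm_divide norm_power norm_inverse divide_inverse mult_ac)
    qed
    then have "(\<lambda>x. norm (g x)) summable_on UNIV \<times> UNIV"
      by (intro Infinite_Sum.abs_summable_on_comparison_test'[OF summable_on_cmult_right[OF summable_on_product_real[OF f(1) f(1) f(2) f(2)]]])
        auto
    then show ?thesis by (rule abs_summable_summable)
  qed
  from has_sum_SigmaI[OF inner has_sum_cmult_right[OF T[folded P_def]] this]
  have "(g has_sum (qpoch_inf y q / qpoch_inf (a * q) q * T)) (UNIV \<times> UNIV)" by simp
  \<comment> \<open>The same absolutely convergent series arranged along the diagonals r + m = n: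
    each inner sum is then finite and equals the term with \<open>\<beta> n\<close>.\<close>
  also have "?this \<longleftrightarrow> ((\<lambda>(n, r). g (r, n - r)) has_sum (qpoch_inf y q / qpoch_inf (a * q) q * T)) (SIGMA n:UNIV. {..n})"
    by (rule has_sum_reindex_bij_witness[where j = "\<lambda>(r, m). (r + m, r)" and i = "\<lambda>(n, r). (r, n - r)"]) auto
  finally have "((\<lambda>(n, r). g (r, n - r)) has_sum (qpoch_inf y q / qpoch_inf (a * q) q * T)) (SIGMA n:UNIV. {..n})" .
  then have "((\<lambda>n. (-1) ^ n * q ^ (n choose 2) * P n * \<beta> n)
      has_sum (qpoch_inf y q / qpoch_inf (a * q) q * T)) UNIV"
  proof (rule has_sum_SigmaD)
    fix n
    have "(-1) ^ n * q ^ (n choose 2) * P n * \<beta> n = (\<Sum>r\<le>n. case (n, r) of (n, r) \<Rightarrow> g (r, n - r))"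
      using pair unfolding bailey_pair_def sum_distrib_left
      by (auto simp: g_def sum_distrib_left add.commute mult_2 intro!: sum.cong)
    then show "((\<lambda>r. case (n, r) of (n, r) \<Rightarrow> g (r, n - r)) has_sum
        (-1) ^ n * q ^ (n choose 2) * P n * \<beta> n) {..n}"
      by (intro has_sum_finiteI) auto
  qed
  then show ?thesis by (simp add: P_def)
qed

subsection \<open>The Jacobi triple product\<close>

text \<open>This is the q-binomial theorem divided by (q; q)_N, proved by the q-Pascal rule: the
  parts of \<open>F N * (1 + x * q ^ N)\<close> contribute 1 - q^(N+1-k) and q^(N+1-k) (1 - q^k) to
  the k-th term, and these add up to 1 - q^(N+1).\<close>

lemma q_binomial:
  assumes q: "norm q < 1"
  shows "(\<Sum>k\<le>N. q ^ (k choose 2) * x ^ k / (qpoch q q k * qpoch q q (N - k)))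
    = qpoch (- x) q N / qpoch q q N"
proof -
  define F where "F N = (\<Sum>k\<le>N. q ^ (k choose 2) * x ^ k / (qpoch q q k * qpoch q q (N - k)))" for N
  have step: "F (Suc N) * (1 - q ^ Suc N) = F N * (1 + x * q ^ N)" for N
  proof -
    define D where "D k = q ^ (k choose 2) * x ^ k / (qpoch q q k * qpoch q q (Suc N - k))" for k
    have D1: "q ^ (k choose 2) * x ^ k / (qpoch q q k * qpoch q q (N - k)) = D k * (1 - q ^ (Suc N - k))"
      if "k \<le> N" for k
      using that qpoch_factor_nonzero[OF q q, of "N - k"]
      by (simp add: D_def Suc_diff_le qpoch_Suc mult_ac)
    have D2: "q ^ (k choose 2) * x ^ k / (qpoch q q k * qpoch q q (N - k)) * (x * q ^ N)
        = D (Suc k) * (q ^ (N - k) * (1 - q ^ Suc k))" if "k \<le> N" for k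
    proof -
      have "q ^ N = q ^ k * q ^ (N - k)" using that by (simp add: power_add [symmetric])
      then show ?thesis
        using qpoch_factor_nonzero[OF q q, of k]
        by (simp add: D_def qpoch_Suc choose_two_Suc power_add mult_ac)
    qed
    have "F N = (\<Sum>k\<le>Suc N. D k * (1 - q ^ (Suc N - k)))"
      unfolding F_def using D1 by simp
    moreover have "F N * (x * q ^ N) = (\<Sum>k\<le>N. D (Suc k) * (q ^ (N - k) * (1 - q ^ Suc k)))"
      unfolding F_def sum_distrib_right using D2 by simp
    then have "F N * (x * q ^ N) = (\<Sum>k\<le>Suc N. D k * (q ^ (Suc N - k) * (1 - q ^ k)))"
      by (simp add: sum.atMost_Suc_shift del: sum.atMost_Suc)
    ultimately have "F N * (1 + x * q ^ N)
        = (\<Sum>k\<le>Suc N. D k * (1 - q ^ (Suc N - k)) + D k * (q ^ (Suc N - k) * (1 - q ^ k)))"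
      by (simp add: distrib_left sum.distrib)
    also have "\<dots> = (\<Sum>k\<le>Suc N. D k * (1 - q ^ Suc N))"
    proof (intro sum.cong refl)
      fix k assume "k \<in> {..Suc N}"
      then have "q ^ Suc N = q ^ (Suc N - k) * q ^ k" by (simp add: power_add [symmetric])
      then show "D k * (1 - q ^ (Suc N - k)) + D k * (q ^ (Suc N - k) * (1 - q ^ k)) = D k * (1 - q ^ Suc N)"
        by (simp add: algebra_simps)
    qed
    also have "\<dots> = F (Suc N) * (1 - q ^ Suc N)"
      unfolding F_def D_def sum_distrib_right ..
    finally show ?thesis ..
  qed
  have "F N = qpoch (- x) q N / qpoch q q N"
  proof (induction N)
    case (Suc N)
    have "1 - q ^ Suc N \<noteq> 0" using qpoch_factor_nonzero[OF q q, of N] by simp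
    then have "F (Suc N) = F N * (1 + x * q ^ N) / (1 - q ^ Suc N)"
      unfolding step[of N, symmetric] by simp
    then show ?case by (simp add: Suc.IH qpoch_Suc mult_ac)
  qed (simp add: F_def)
  then show ?thesis by (simp add: F_def)
qed

text \<open>Each factor 1 + x/p^k with 1 \<le> k \<le> m equals x/p^k times 1 + p^k/x; the extracted
  powers of p multiply to the triangular power.\<close>

lemma qpoch_reverse:
  assumes "p \<noteq> 0" "x \<noteq> 0"
  shows "qpoch (- (x / p ^ m)) p m = x ^ m / p ^ (Suc m choose 2) * qpoch (- (p / x)) p m"
proof (induction m)
  case (Suc m)
  have "qpoch (- (x / p ^ Suc m)) p (Suc m) = (1 + x / p ^ Suc m) * qpoch (- (x / p ^ m)) p m"
    using assms unfolding qpoch_Suc_shift by simp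
  also have "1 + x / p ^ Suc m = x / p ^ Suc m * (1 + p / x * p ^ m)"
    using assms by (simp add: field_simps)
  finally show ?case
    unfolding Suc.IH choose_two_Suc[of "Suc m"] qpoch_Suc power_add
    by (simp add: mult_ac)
qed simp

text \<open>The second summand is the term p^(n(n-1)/2) x^n at n = -r-1, where n(n-1)/2 =
  (r+1)(r+2)/2.\<close>

definition jtp_term :: "complex \<Rightarrow> complex \<Rightarrow> nat \<Rightarrow> complex" where
  "jtp_term p x r = p ^ (r choose 2) * x ^ r + p ^ ((r + 2) choose 2) / x ^ (r + 1)"

text \<open>The terms of index \<open>r\<close> and \<open>-r-1\<close> of the bilateral series carry the same \<open>q\<close>-binomial coefficient
  when the number of factors is odd, so the series can be folded to one over the naturals.\<close>

lemma finite_jtp: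
  assumes p: "norm p < 1" "p \<noteq> 0" and x: "x \<noteq> 0"
  shows "(\<Sum>r\<le>n. jtp_term p x r / (qpoch p p (n - r) * qpoch p p (n + 1 + r)))
    = qpoch (- x) p n * qpoch (- (p / x)) p (n + 1) / qpoch p p (2 * n + 1)"
proof -
  \<comment> \<open>The shift by \<open>n + 1\<close> places index 0 of the bilateral series at
    position \<open>n + 1\<close> of the q-binomial sum with 2n+1 factors; \<open>c\<close> is the
    factor common to all terms after this recentring.\<close>
  define X where "X = x / p ^ (n + 1)"
  define c where "c = x ^ (n + 1) / p ^ ((n + 2) choose 2)"
  define T where "T k = p ^ (k choose 2) * X ^ k / (qpoch p p k * qpoch p p (2 * n + 1 - k))" for k
  have c: "c \<noteq> 0" using p x by (simp add: c_def)
  have upper: "T (n + 1 + r) = c * (p ^ (r choose 2) * x ^ r) / (qpoch p p (n - r) * qpoch p p (n + 1 + r))"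
    if "r \<le> n" for r
  proof -
    have "((n + 1 + r) choose 2) + ((n + 2) choose 2) = (r choose 2) + (n + 1) * (n + 1 + r)"
      using choose_two_square[of n] by (simp add: choose_two_add choose_two_Suc algebra_simps)
    then have "p ^ ((n + 1 + r) choose 2) * p ^ ((n + 2) choose 2) = p ^ (r choose 2) * (p ^ (n + 1)) ^ (n + 1 + r)"
      by (metis power_add power_mult)
    then have E: "p ^ ((n + 1 + r) choose 2) / (p ^ (n + 1)) ^ (n + 1 + r) = p ^ (r choose 2) / p ^ ((n + 2) choose 2)"
      using p by (simp add: frac_eq_eq)
    have "p ^ ((n + 1 + r) choose 2) * X ^ (n + 1 + r)
        = x ^ (n + 1 + r) * (p ^ ((n + 1 + r) choose 2) / (p ^ (n + 1)) ^ (n + 1 + r))"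
      by (simp only: X_def power_divide times_divide_eq_right mult.commute)
    then have "p ^ ((n + 1 + r) choose 2) * X ^ (n + 1 + r) = c * (p ^ (r choose 2) * x ^ r)"
      unfolding E by (simp add: c_def power_add mult_ac)
    moreover have "2 * n + 1 - (n + 1 + r) = n - r" by simp
    ultimately show ?thesis unfolding T_def by (simp only: mult_ac)
  qed
  have lower: "T (n - r) = c * (p ^ ((r + 2) choose 2) / x ^ (r + 1)) / (qpoch p p (n - r) * qpoch p p (n + 1 + r))"
    if "r \<le> n" for r
  proof -
    define k where "k = n - r"
    have n: "n = k + r" using that by (simp add: k_def)
    have "(k choose 2) + ((n + 2) choose 2) = ((r + 2) choose 2) + (n + 1) * k"
      using choose_two_square[of k] unfolding n
      by (simp add: choose_two_add choose_two_Suc algebra_simps)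
    then have "p ^ (k choose 2) * p ^ ((n + 2) choose 2) = p ^ ((r + 2) choose 2) * (p ^ (n + 1)) ^ k"
      by (metis power_add power_mult)
    then have E: "p ^ (k choose 2) / (p ^ (n + 1)) ^ k = p ^ ((r + 2) choose 2) / p ^ ((n + 2) choose 2)"
      using p by (simp add: frac_eq_eq)
    have xk: "x ^ k = x ^ (n + 1) / x ^ (r + 1)"
      using x by (simp add: n power_add)
    have "p ^ (k choose 2) * X ^ k = x ^ k * (p ^ (k choose 2) / (p ^ (n + 1)) ^ k)"
      by (simp only: X_def power_divide times_divide_eq_right mult.commute)
    then have "p ^ (k choose 2) * X ^ k = c * (p ^ ((r + 2) choose 2) / x ^ (r + 1))"
      unfolding E xk c_def by (simp only: times_divide_eq_left times_divide_eq_right divide_divide_eq_left mult_ac)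
    moreover have "2 * n + 1 - (n - r) = n + 1 + r" using that by simp
    ultimately show ?thesis unfolding T_def k_def by (simp only:)
  qed
  have "(\<Sum>k\<le>2 * n + 1. T k) = (\<Sum>k\<le>n. T k) + (\<Sum>k=Suc n..n + (n + 1). T k)"
    using sum_up_index_split[of T n "n + 1"] by (simp add: mult_2)
  also have "(\<Sum>k=Suc n..n + (n + 1). T k) = (\<Sum>r\<le>n. T (n + 1 + r))"
    using sum.shift_bounds_cl_nat_ivl[of T 0 "n + 1" n] by (simp add: atLeast0AtMost add_ac)
  also have "(\<Sum>k\<le>n. T k) = (\<Sum>r\<le>n. T (n - r))"
    using sum.atLeastAtMost_rev[of T 0 n] by (simp add: atLeast0AtMost)
  also have "(\<Sum>r\<le>n. T (n - r)) + (\<Sum>r\<le>n. T (n + 1 + r))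
      = (\<Sum>r\<le>n. c * (jtp_term p x r / (qpoch p p (n - r) * qpoch p p (n + 1 + r))))"
    unfolding sum.distrib [symmetric]
  proof (intro sum.cong refl)
    fix r assume "r \<in> {..n}"
    have *: "c * B / D + c * A / D = c * ((A + B) / D)" for A B D
      by (simp add: add_divide_distrib distrib_left)
    show "T (n - r) + T (n + 1 + r) = c * (jtp_term p x r / (qpoch p p (n - r) * qpoch p p (n + 1 + r)))"
      using \<open>r \<in> {..n}\<close> by (simp only: upper lower atMost_iff jtp_term_def *)
  qed
  finally have "c * (\<Sum>r\<le>n. jtp_term p x r / (qpoch p p (n - r) * qpoch p p (n + 1 + r)))
      = qpoch (- X) p (2 * n + 1) / qpoch p p (2 * n + 1)"
    using q_binomial[OF p(1), of X "2 * n + 1"] by (simp add: T_def sum_distrib_left)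
  \<comment> \<open>The last n factors start at \<open>- x\<close>; the first n+1 contain negative
    powers of p and are reversed, which reproduces exactly the constant \<open>c\<close>.\<close>
  also have "qpoch (- X) p (2 * n + 1) = qpoch (- X) p (n + 1) * qpoch (- X * p ^ (n + 1)) p n"
    using qpoch_add[of "- X" p "n + 1" n] by (simp add: mult_2)
  also have "- X * p ^ (n + 1) = - x" using p by (simp add: X_def)
  also have "qpoch (- X) p (n + 1) = c * qpoch (- (p / x)) p (n + 1)"
    unfolding X_def c_def using qpoch_reverse[OF p(2) x, of "n + 1"] by simp
  finally have "c * (\<Sum>r\<le>n. jtp_term p x r / (qpoch p p (n - r) * qpoch p p (n + 1 + r)))
      = c * (qpoch (- x) p n * qpoch (- (p / x)) p (n + 1) / qpoch p p (2 * n + 1))"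
    by (simp only: times_divide_eq_right mult_ac)
  then show ?thesis using c by (simp only: mult_cancel_left simp_thms)
qed

lemma jtp_term_summable:
  assumes "norm p < 1" "x \<noteq> 0"
  shows "summable (\<lambda>r. norm (jtp_term p x r))"
proof -
  define f where "f r = norm p ^ (r choose 2) * (1 / norm x) ^ r" for r
  have "summable (\<lambda>r. norm x * f (r + 2))"
    unfolding f_def using assms
    by (intro summable_mult summable_ignore_initial_segment[of _ 2] summable_power_choose_two) auto
  moreover have "norm x * f (r + 2) = norm (p ^ ((r + 2) choose 2) / x ^ (r + 1))" for r
    using assms by (simp add: f_def norm_mult norm_divide norm_power field_simps)
  ultimately have "summable (\<lambda>r. norm (p ^ ((r + 2) choose 2) / x ^ (r + 1)))" by (simp only:)
  moreover have "summable (\<lambda>r. norm (p ^ (r choose 2) * x ^ r))"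
    using summable_power_choose_two[of "norm p" "norm x"] assms by (simp add: norm_mult norm_power)
  ultimately have "summable (\<lambda>r. norm (p ^ ((r + 2) choose 2) / x ^ (r + 1)) + norm (p ^ (r choose 2) * x ^ r))"
    by (rule summable_add)
  then show ?thesis
    unfolding jtp_term_def
  proof (rule summable_comparison_test')
    show "norm (norm (p ^ (r choose 2) * x ^ r + p ^ ((r + 2) choose 2) / x ^ (r + 1)))
        \<le> norm (p ^ ((r + 2) choose 2) / x ^ (r + 1)) + norm (p ^ (r choose 2) * x ^ r)" for r
      unfolding real_norm_def abs_norm_cancel by (subst add.commute) (rule norm_triangle_ineq)
  qed
qed

text \<open>As n tends to infinity in the finite form, each coefficient on the left tends to 1/P^2
  under a uniform bound, and the right side tends to the two infinite products over P, where P = (p;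
  p)_\<infinity>. Clearing denominators leaves one factor P.\<close>

theorem jacobi_triple_product:
  assumes p: "norm p < 1" "p \<noteq> 0" and x: "x \<noteq> 0"
  shows "(jtp_term p x has_sum (qpoch_inf (- x) p * qpoch_inf (- (p / x)) p * qpoch_inf p p)) UNIV"
proof -
  define a where "a r n = (if r \<le> n then jtp_term p x r / (qpoch p p (n - r) * qpoch p p (n + 1 + r)) else 0)" for r n
  obtain K where K: "K > 0" "\<And>n. norm (inverse (qpoch p p n)) \<le> K"
    using inverse_qpoch_bounded[OF p(1) p(1)] by blast
  define P where "P = qpoch_inf p p"
  have P: "P \<noteq> 0" unfolding P_def by (intro qpoch_inf_nonzero p)
  have "(\<lambda>n. \<Sum>r. a r n) \<longlonglongrightarrow> (\<Sum>r. jtp_term p x r / (P * P))"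
  proof (rule conjunct2[OF conjunct2[OF tannerys_theorem[where M = "\<lambda>r. norm (jtp_term p x r) * (K * K)"]]])
    fix r
    \<comment> \<open>Replacing n by n + r removes both the case distinction and the truncated
      difference \<open>n - r\<close>.\<close>
    have "(\<lambda>n. jtp_term p x r / (qpoch p p n * qpoch p p (n + (1 + 2 * r)))) \<longlonglongrightarrow> jtp_term p x r / (P * P)"
      unfolding P_def using P[unfolded P_def]
      by (intro tendsto_intros qpoch_tendsto LIMSEQ_ignore_initial_segment p) auto
    moreover have "a r (n + r) = jtp_term p x r / (qpoch p p n * qpoch p p (n + (1 + 2 * r)))" for n
      by (simp add: a_def mult_2 add_ac)
    ultimately have "(\<lambda>n. a r (n + r)) \<longlonglongrightarrow> jtp_term p x r / (P * P)" by simp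
    then show "(\<lambda>n. a r n) \<longlonglongrightarrow> jtp_term p x r / (P * P)" by (rule LIMSEQ_offset)
  next
    have "norm (a r n) \<le> norm (jtp_term p x r) * (K * K)" for r n
    proof -
      have "norm (inverse (qpoch p p (n - r))) * norm (inverse (qpoch p p (n + 1 + r))) \<le> K * K"
        using K by (intro mult_mono) auto
      then have "norm (jtp_term p x r) * (norm (inverse (qpoch p p (n - r))) * norm (inverse (qpoch p p (n + 1 + r))))
          \<le> norm (jtp_term p x r) * (K * K)"
        by (intro mult_left_mono) auto
      then show ?thesis
        using K(1) by (auto simp: a_def norm_divide norm_mult norm_inverse divide_inverse mult_ac)
    qed
    then show "\<forall>\<^sub>F (r, n) in sequentially \<times>\<^sub>F sequentially. norm (a r n) \<le> norm (jtp_term p x r) * (K * K)"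
      by (intro always_eventually) auto
    show "summable (\<lambda>r. norm (jtp_term p x r) * (K * K))"
      by (intro summable_mult2 jtp_term_summable p x)
  qed simp
  moreover have "(\<Sum>r. a r n) = qpoch (- x) p n * qpoch (- (p / x)) p (n + 1) / qpoch p p (2 * n + 1)" for n
  proof -
    have "(\<Sum>r. a r n) = (\<Sum>r\<le>n. a r n)"
      by (rule suminf_finite) (auto simp: a_def)
    then show ?thesis using finite_jtp[OF p x, of n] by (simp add: a_def)
  qed
  moreover have "(\<lambda>n. qpoch (- x) p n * qpoch (- (p / x)) p (n + 1) / qpoch p p (2 * n + 1))
      \<longlonglongrightarrow> qpoch_inf (- x) p * qpoch_inf (- (p / x)) p / P"
  proof -
    have "filterlim (\<lambda>n::nat. 2 * n + 1) at_top sequentially"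
      by (intro filterlim_subseq) (auto simp: strict_mono_def)
    from filterlim_compose[OF qpoch_tendsto[OF p(1), of p] this]
    show ?thesis unfolding P_def using P[unfolded P_def]
      by (intro tendsto_intros qpoch_tendsto LIMSEQ_ignore_initial_segment p) 
  qed
  ultimately have "(\<Sum>r. jtp_term p x r / (P * P)) = qpoch_inf (- x) p * qpoch_inf (- (p / x)) p / P"
    using LIMSEQ_unique by simp
  moreover have summ: "summable (jtp_term p x)"
    by (intro summable_norm_cancel[OF jtp_term_summable] p x)
  ultimately have "(\<Sum>r. jtp_term p x r) = qpoch_inf (- x) p * qpoch_inf (- (p / x)) p * P"
    using P by (simp add: suminf_divide field_simps)
  then have "jtp_term p x sums (qpoch_inf (- x) p * qpoch_inf (- (p / x)) p * P)"
    using summable_sums[OF summ] by simp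
  then show ?thesis
    unfolding P_def by (intro norm_summable_imp_has_sum jtp_term_summable p x)
qed

subsection \<open>Reduction of the triple sums to Bailey pairs\<close>

lemma has_sum_product:
  fixes f :: "'a \<Rightarrow> complex" and g :: "'b \<Rightarrow> complex"
  assumes "(f has_sum a) A" "(g has_sum b) B"
  shows "((\<lambda>(x, y). f x * g y) has_sum (a * b)) (A \<times> B)"
proof (rule has_sum_SigmaI)
  show "((\<lambda>y. case (x, y) of (x, y) \<Rightarrow> f x * g y) has_sum f x * b) B" for x
    using assms by (auto intro!: has_sum_cmult_right)
  show "((\<lambda>x. f x * b) has_sum a * b) A"
    using assms by (intro has_sum_cmult_left)
  have "(\<lambda>x. norm (f x)) summable_on A" "(\<lambda>y. norm (g y)) summable_on B"
    using assms has_sum_imp_summable summable_on_iff_abs_summable_on_complex by blast+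
  from summable_on_product_real[OF this]
  have "(\<lambda>z. norm (case z of (x, y) \<Rightarrow> f x * g y)) summable_on A \<times> B"
    by (simp add: case_prod_unfold norm_mult)
  then show "(\<lambda>(x, y). f x * g y) summable_on A \<times> B" by (rule abs_summable_summable)
qed

text \<open>The quadratic form common to the five sums: the exponent of the first one, and half the
  exponent of the others up to linear terms. Values are integers because of the term -ik; both
  divisions by 2 are exact.\<close>

definition triple_exponent :: "nat \<Rightarrow> nat \<Rightarrow> nat \<Rightarrow> int" where
  "triple_exponent i j k = int i ^ 2 + int i * int j - int i * int k
     + (int j ^ 2 - int j) div 2 + (int k ^ 2 - int k) div 2"

lemma square_diff_div_two: "(int n ^ 2 - int n) div 2 = int (n choose 2)"
proof -
  have "int n ^ 2 = 2 * int (n choose 2) + int n"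
    using arg_cong[OF choose_two_square[of n], of int] by (simp add: power2_eq_square)
  then show ?thesis by simp
qed

lemma triple_exponent_eq:
  "triple_exponent i j k = int (i * i + i * j + (j choose 2) + (k choose 2)) - int (i * k)"
  unfolding triple_exponent_def square_diff_div_two by (simp add: power2_eq_square)

text \<open>Completing squares, with -ik absorbed in a square of k - i, yields a linear lower bound.
  The constant 6 is one that leaves a nonnegative remainder; linear growth suffices for a product of
  three geometric majorants.\<close>

lemma triple_exponent_ge: "triple_exponent i j k \<ge> int (i + j + k) - 6"
proof -
  have sq: "2 * int (n choose 2) = int n * int n - int n" for n
    using arg_cong[OF choose_two_square[of n], of int] by simp
  have "8 * (triple_exponent i j k - (int (i + j + k) - 6))
      = (2 * int j - 3) ^ 2 + (2 * int k - 2 * int i - 3) ^ 2 + (2 * int i - 5) ^ 2 + 8 * (int i * int j) + 5"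
    using sq[of j] sq[of k] by (simp add: triple_exponent_eq power2_eq_square algebra_simps)
  also have "\<dots> \<ge> 0" by simp
  finally show ?thesis by simp
qed

lemma triple_summable:
  fixes p U V W :: complex
  assumes p: "norm p < 1" "p \<noteq> 0" and le: "norm U \<le> 1" "norm V \<le> 1" "norm W \<le> 1"
  shows "(\<lambda>(i, j, k). U ^ i * V ^ j * W ^ k * p powi triple_exponent i j k
            / (qpoch p p i * qpoch p p j * qpoch p p k)) summable_on UNIV \<times> (UNIV \<times> UNIV)"
proof -
  obtain K where K: "K > 0" "\<And>n. norm (inverse (qpoch p p n)) \<le> K"
    using inverse_qpoch_bounded[OF p(1) p(1)] by blast
  define f where "f n = norm p ^ n" for n
  have f: "f summable_on UNIV" "\<And>n. f n \<ge> 0"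
    unfolding f_def using p by (auto intro!: summable_nonneg_imp_summable_on summable_geometric)
  have bound: "norm (U ^ i * V ^ j * W ^ k * p powi triple_exponent i j k / (qpoch p p i * qpoch p p j * qpoch p p k))
      \<le> (K * K * K / norm p ^ 6) * (f i * (f j * f k))" for i j k
  proof -
    have "norm (U ^ i * V ^ j * W ^ k) \<le> 1 * 1 * 1"
      unfolding norm_mult norm_power using le by (intro mult_mono power_le_one) auto
    moreover have "norm (inverse (qpoch p p i)) * norm (inverse (qpoch p p j)) * norm (inverse (qpoch p p k)) \<le> K * K * K"
      using K by (intro mult_mono) auto
    ultimately have 1: "norm (U ^ i * V ^ j * W ^ k) *
        (norm (inverse (qpoch p p i)) * norm (inverse (qpoch p p j)) * norm (inverse (qpoch p p k))) \<le> 1 * (K * K * K)"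
      by (intro mult_mono[of "norm (U ^ i * V ^ j * W ^ k)"]) auto
    have "norm p powi triple_exponent i j k \<le> norm p powi (int (i + j + k) - int 6)"
      using p triple_exponent_ge[of i j k] by (intro power_int_decreasing) auto
    also have "\<dots> = f i * (f j * f k) / norm p ^ 6"
      using p unfolding f_def by (subst power_int_diff) (auto simp: power_int_of_nat power_add simp del: of_nat_add of_nat_numeral)
    finally have "norm (U ^ i * V ^ j * W ^ k) *
        (norm (inverse (qpoch p p i)) * norm (inverse (qpoch p p j)) * norm (inverse (qpoch p p k)))
        * norm p powi triple_exponent i j k \<le> 1 * (K * K * K) * (f i * (f j * f k) / norm p ^ 6)"
      by (rule mult_mono[OF 1]) (use K in auto)
    then show ?thesis
      by (simp add: norm_mult norm_divide norm_power norm_power_int norm_inverse divide_inverse mult_ac)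
  qed
  have "(\<lambda>(i, j, k). f i * (f j * f k)) summable_on UNIV \<times> (UNIV \<times> UNIV)"
    using summable_on_product_real[OF f(1) summable_on_product_real[OF f(1) f(1) f(2) f(2)] f(2)] f(2)
    by (simp add: case_prod_unfold)
  from summable_on_cmult_right[OF this, of "K * K * K / norm p ^ 6"]
  have "(\<lambda>x. norm (case x of (i, j, k) \<Rightarrow> U ^ i * V ^ j * W ^ k * p powi triple_exponent i j k
            / (qpoch p p i * qpoch p p j * qpoch p p k))) summable_on UNIV \<times> (UNIV \<times> UNIV)"
    by (rule Infinite_Sum.abs_summable_on_comparison_test') (use bound in auto)
  then show ?thesis by (rule abs_summable_summable)
qed

text \<open>The factors are 1 + w/p^k = (w + p^k)/p^k for k = 1, ..., i. Leaving \<open>w\<close>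
  inside the product keeps the formula valid at w = 0.\<close>

lemma qpoch_negative_shift:
  assumes "p \<noteq> 0"
  shows "qpoch (- (w / p ^ i)) p i = (\<Prod>m<i. w + p ^ Suc m) / p ^ (Suc i choose 2)"
proof (induction i)
  case (Suc i)
  have "qpoch (- (w / p ^ Suc i)) p (Suc i) = (1 + w / p ^ Suc i) * qpoch (- (w / p ^ i)) p i"
    using assms unfolding qpoch_Suc_shift by simp
  also have "1 + w / p ^ Suc i = (w + p ^ Suc i) / p ^ Suc i"
    using assms by (simp add: add_divide_distrib add.commute)
  finally show ?case
    unfolding Suc.IH choose_two_Suc[of "Suc i"] power_add by (simp add: mult_ac)
qed simp

text \<open>For fixed i the sums over j and k separate into Euler sums at \<open>V * p ^ i\<close>
  and \<open>W / p ^ i\<close>. The second product is reduced to the i-free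
  \<open>qpoch_inf (- W) p\<close> by extracting its first i factors.\<close>

theorem triple_has_sum:
  fixes p U V W :: complex
  assumes p: "norm p < 1" "p \<noteq> 0" and le: "norm U \<le> 1" "norm V \<le> 1" "norm W \<le> 1"
    and S: "((\<lambda>i. U ^ i * p ^ (i choose 2) * (\<Prod>m<i. W + p ^ Suc m) / qpoch p p i * qpoch_inf (- V * p ^ i) p)
              has_sum S) UNIV"
  shows "((\<lambda>(i, j, k). U ^ i * V ^ j * W ^ k * p powi triple_exponent i j k
            / (qpoch p p i * qpoch p p j * qpoch p p k)) has_sum (qpoch_inf (- W) p * S)) UNIV"
proof -
  define t where "t = (\<lambda>(i, j, k). U ^ i * V ^ j * W ^ k * p powi triple_exponent i j k
            / (qpoch p p i * qpoch p p j * qpoch p p k))"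
  have inner: "((\<lambda>jk. t (i, jk)) has_sum (qpoch_inf (- W) p *
      (U ^ i * p ^ (i choose 2) * (\<Prod>m<i. W + p ^ Suc m) / qpoch p p i * qpoch_inf (- V * p ^ i) p)))
      (UNIV \<times> UNIV)" for i
  proof -
    define g where "g x n = p ^ (n choose 2) * x ^ n / qpoch p p n" for x n
    have "((\<lambda>(j, k). g (V * p ^ i) j * g (W / p ^ i) k)
        has_sum (qpoch_inf (- (V * p ^ i)) p * qpoch_inf (- (W / p ^ i)) p)) (UNIV \<times> UNIV)"
      unfolding g_def by (intro has_sum_product euler_has_sum p)
    from has_sum_cmult_right[OF this, of "U ^ i * p ^ (i * i) / qpoch p p i"]
    have "((\<lambda>jk. t (i, jk)) has_sum (U ^ i * p ^ (i * i) / qpoch p p i *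
        (qpoch_inf (- (V * p ^ i)) p * qpoch_inf (- (W / p ^ i)) p))) (UNIV \<times> UNIV)"
    proof (rule iffD1[OF has_sum_cong, rotated], safe)
      fix j k
      have "p powi triple_exponent i j k = p ^ (i * i) * (p ^ i) ^ j * p ^ (j choose 2) * p ^ (k choose 2) / (p ^ i) ^ k"
        unfolding triple_exponent_eq power_int_diff[OF disjI1[OF p(2)]] power_int_of_nat
        by (simp add: power_add power_mult)
      then show "U ^ i * p ^ (i * i) / qpoch p p i * (g (V * p ^ i) j * g (W / p ^ i) k) = t (i, j, k)"
        by (simp add: t_def g_def power_mult_distrib power_divide mult_ac)
    qed
    moreover have "U ^ i * p ^ (i * i) / qpoch p p i * (qpoch_inf (- (V * p ^ i)) p * qpoch_inf (- (W / p ^ i)) p)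
      = qpoch_inf (- W) p * (U ^ i * p ^ (i choose 2) * (\<Prod>m<i. W + p ^ Suc m) / qpoch p p i * qpoch_inf (- V * p ^ i) p)"
    proof -
      \<comment> \<open>The larger half of p^(i^2) is consumed by the negative powers in the
        extracted factors; the smaller half becomes the weight of the single series.\<close>
      have "i * i = (i choose 2) + (Suc i choose 2)"
        using choose_two_square[of i] by (simp add: choose_two_Suc)
      then have 1: "p ^ (i * i) / p ^ (Suc i choose 2) = p ^ (i choose 2)"
        using p by (simp add: power_add)
      have 2: "qpoch_inf (- (W / p ^ i)) p = (\<Prod>m<i. W + p ^ Suc m) / p ^ (Suc i choose 2) * qpoch_inf (- W) p"
        using qpoch_inf_shift[OF p(1), of "- (W / p ^ i)" i] p qpoch_negative_shift[OF p(2), of W i] by simp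
      have 3: "u * a / d * (v * (r / c * w)) = w * (u * (a / c) * r / d * v)" for a c d r u v w :: complex
        by (simp add: mult_ac)
      show ?thesis unfolding 2 1 [symmetric] mult_minus_left by (rule 3)
    qed
    ultimately show ?thesis by (simp only:)
  qed
  have "t summable_on UNIV \<times> (UNIV \<times> UNIV)"
    unfolding t_def by (rule triple_summable[OF p le])
  from has_sum_SigmaI[OF inner has_sum_cmult_right[OF S] this]
  show ?thesis by (simp add: t_def)
qed

text \<open>Writing (-V p^i; p)_\<infinity> as (-V; p)_\<infinity> / (-V; p)_i produces the required
  \<open>\<beta>\<close>; |V| < 1 keeps the denominator nonzero. Bailey's lemma is applied with a =
  U and y = -UW, so that each factor y - U p^m is -U (W + p^m) and the signs (-1)^n cancel.\<close>

theorem triple_bailey: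
  fixes p U V W :: complex
  assumes p: "norm p < 1" "p \<noteq> 0" and le: "norm U \<le> 1" "norm V < 1" "norm W \<le> 1" "norm (U * W) < 1"
    and pair: "bailey_pair U p \<alpha> (\<lambda>n. 1 / (qpoch p p n * qpoch (- V) p n))"
    and bdd: "\<And>r. norm (\<alpha> r) \<le> A"
    and T: "((\<lambda>r. U ^ r * p ^ (r choose 2) * (\<Prod>k<r. W + p ^ Suc k) / qpoch (- (U * W)) p r * \<alpha> r) has_sum T) UNIV"
  shows "((\<lambda>(i, j, k). U ^ i * V ^ j * W ^ k * p powi triple_exponent i j k
            / (qpoch p p i * qpoch p p j * qpoch p p k)) has_sum
            (qpoch_inf (- V) p * qpoch_inf (- W) p * qpoch_inf (- (U * W)) p / qpoch_inf (U * p) p * T)) UNIV"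
proof -
  have prod_eq: "(-1) ^ n * p ^ (n choose 2) * (\<Prod>k<n. - (U * W) - U * p ^ Suc k)
      = U ^ n * p ^ (n choose 2) * (\<Prod>k<n. W + p ^ Suc k)" for n
  proof -
    have "(-1) ^ n * (\<Prod>k<n. - (U * W) - U * p ^ Suc k) = U ^ n * (\<Prod>k<n. W + p ^ Suc k)"
      by (induction n) (simp_all add: algebra_simps)
    then show ?thesis by (simp add: mult_ac)
  qed
  have "((\<lambda>n. U ^ n * p ^ (n choose 2) * (\<Prod>k<n. W + p ^ Suc k) * (1 / (qpoch p p n * qpoch (- V) p n)))
      has_sum (qpoch_inf (- (U * W)) p / qpoch_inf (U * p) p * T)) UNIV"
    using bailey_limit[OF p(1) le(1) _ pair bdd, of "- (U * W)" T] T le(4)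
    unfolding prod_eq by simp
  from has_sum_cmult_right[OF this, of "qpoch_inf (- V) p"]
  have "((\<lambda>i. U ^ i * p ^ (i choose 2) * (\<Prod>m<i. W + p ^ Suc m) / qpoch p p i * qpoch_inf (- V * p ^ i) p)
      has_sum (qpoch_inf (- V) p * (qpoch_inf (- (U * W)) p / qpoch_inf (U * p) p * T))) UNIV"
  proof (rule iffD1[OF has_sum_cong, rotated])
    fix i
    have "qpoch (- V) p i \<noteq> 0" using qpoch_nonzero[OF p(1), of "- V"] le by simp
    then show "qpoch_inf (- V) p * (U ^ i * p ^ (i choose 2) * (\<Prod>k<i. W + p ^ Suc k) * (1 / (qpoch p p i * qpoch (- V) p i)))
      = U ^ i * p ^ (i choose 2) * (\<Prod>m<i. W + p ^ Suc m) / qpoch p p i * qpoch_inf (- V * p ^ i) p"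
      unfolding qpoch_inf_shift[OF p(1), of "- V" i] by (simp add: mult_ac)
  qed
  from triple_has_sum[OF p le(1) less_imp_le[OF le(2)] le(3) this] show ?thesis
    by (simp add: mult_ac)
qed

subsection \<open>Theta functions and eta quotients\<close>

lemma norm_power_less_1:
  fixes q :: complex
  assumes "norm q < 1" "n > 0"
  shows "norm (q ^ n) < 1"
  using assms by (simp add: norm_power power_less_one_iff)

lemma J_nonzero:
  assumes "norm q < 1" "m > 0"
  shows "J m q \<noteq> 0"
  unfolding J_def using norm_power_less_1[OF assms] by (intro qpoch_inf_nonzero)

lemma J_power: "J m (q ^ n) = J (n * m) q"
  by (simp add: J_def power_mult)

lemma qpoch_inf_odd:
  assumes "norm q < 1"
  shows "qpoch_inf q (q ^ 2) = J 1 q / J 2 q"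
proof -
  have "{..<2::nat} = {0, 1}" by auto
  then have "J 1 q = qpoch_inf q (q ^ 2) * J 2 q"
    using qpoch_inf_split[OF assms, of 2 q] by (simp add: J_def power2_eq_square)
  then show ?thesis using J_nonzero[OF assms, of 2] by simp
qed

lemma qpoch_inf_minus_base:
  assumes "norm q < 1"
  shows "qpoch_inf (- q) q = J 2 q / J 1 q"
  using qpoch_inf_mult_uminus[OF assms, of q] J_nonzero[OF assms, of 1]
  by (simp add: J_def field_simps)

lemma qpoch_inf_minus_odd:
  assumes "norm q < 1"
  shows "qpoch_inf (- q) (q ^ 2) = J 2 q ^ 2 / (J 1 q * J 4 q)"
proof -
  have q2: "norm (q ^ 2) < 1" using norm_power_less_1[OF assms] by simp
  have "qpoch_inf q (q ^ 2) * qpoch_inf (- q) (q ^ 2) = J 2 q / J 4 q"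
    using qpoch_inf_mult_uminus[OF q2, of q] qpoch_inf_odd[OF q2] by (simp add: J_power)
  then show ?thesis
    unfolding qpoch_inf_odd[OF assms]
    using J_nonzero[OF assms, of 1] J_nonzero[OF assms, of 2] J_nonzero[OF assms, of 4]
    by (simp add: field_simps power2_eq_square)
qed

text \<open>The odd numbers split into the classes 1, 3, 5 mod 6. The whole product is J_1/J_2 and
  the class 3 contributes J_3/J_6, so the quotient gives the two classes wanted.\<close>

lemma qpoch_inf_mod_six:
  assumes "norm q < 1"
  shows "qpoch_inf (q ^ 5) (q ^ 6) * qpoch_inf q (q ^ 6) * J 6 q = J 1 q * J 6 q ^ 2 / (J 2 q * J 3 q)"
proof -
  have q2: "norm (q ^ 2) < 1" and q3: "norm (q ^ 3) < 1"
    using norm_power_less_1[OF assms] by simp_all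
  have "{..<3::nat} = {0, 1, 2}" by auto
  then have "J 1 q / J 2 q = qpoch_inf q (q ^ 6) * (qpoch_inf (q ^ 3) (q ^ 6) * qpoch_inf (q ^ 5) (q ^ 6))"
    using qpoch_inf_split[OF q2, of 3 q] qpoch_inf_odd[OF assms]
    by (simp add: power_mult [symmetric] flip: power_Suc)
  moreover have "qpoch_inf (q ^ 3) (q ^ 6) = J 3 q / J 6 q"
    using qpoch_inf_odd[OF q3] by (simp add: J_power power_mult [symmetric])
  ultimately show ?thesis
    using J_nonzero[OF assms, of 2] J_nonzero[OF assms, of 3] J_nonzero[OF assms, of 6]
    by (simp add: field_simps power2_eq_square)
qed

section \<open>Theta series from the triple product\<close>

lemma double_choose_two_add_2: "2 * ((r + 2) choose 2) = (r + 1) * (r + 1) + (r + 1)"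
  using choose_two_square[of "r + 1"] choose_two_Suc[of "r + 1"] by simp

lemma square_power_choose_two:
  fixes q :: complex
  assumes "q \<noteq> 0"
  shows "(q ^ 2) ^ (r choose 2) = q ^ (r * r) / q ^ r"
proof -
  have "q ^ (r * r) = (q ^ 2) ^ (r choose 2) * q ^ r"
    unfolding choose_two_square[of r, symmetric] by (simp add: power_add power_mult)
  then show ?thesis using assms by simp
qed

text \<open>The triple product in base q^2 at x = -q. The index -r-1 carries the square (r+1)^2, so
  the folded term is \<open>g r + g (Suc r)\<close> and the total is 2G - g(0): the index 0 is
  counted once, every other square twice.\<close>

lemma theta_square_has_sum:
  assumes q: "norm q < 1" "q \<noteq> 0"
  shows "((\<lambda>r. if r = 0 then 1 else 2 * (-1) ^ r * q ^ (r * r)) has_sum (J 1 q ^ 2 / J 2 q)) UNIV"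
proof -
  define g where "g r = (-1) ^ r * q ^ (r * r)" for r
  have q2: "norm (q ^ 2) < 1" using norm_power_less_1[OF q(1)] by simp
  have "norm (g r) \<le> norm q ^ r" for r
    using q by (cases r) (auto simp: g_def norm_mult norm_power intro!: power_decreasing)
  then have summ_norm: "summable (\<lambda>r. norm (g r))"
    using q by (intro summable_comparison_test'[OF summable_geometric[of "norm q"]]) auto
  then obtain G where G: "g sums G"
    using summable_norm_cancel summable_def by blast
  have "jtp_term (q ^ 2) (- q) r = g r + g (Suc r)" for r
  proof -
    have 1: "(q ^ 2) ^ (r choose 2) * (- q) ^ r = g r"
      using q unfolding square_power_choose_two[OF q(2)] power_minus[of q] g_def by simp
    have 2: "(q ^ 2) ^ ((r + 2) choose 2) / (- q) ^ (r + 1) = g (Suc r)"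
      using q unfolding power_mult [symmetric] double_choose_two_add_2 power_minus[of q "r + 1"] g_def
      by (simp add: power_add field_simps)
    show ?thesis unfolding jtp_term_def 1 2 ..
  qed
  moreover have "(\<lambda>r. g r + g (Suc r)) sums (G + (G - g 0))"
    using G by (intro sums_add) (simp_all add: sums_Suc_iff)
  ultimately have "jtp_term (q ^ 2) (- q) sums (G + (G - g 0))" by presburger
  moreover have "jtp_term (q ^ 2) (- q) sums (J 1 q ^ 2 / J 2 q)"
  proof -
    have quot: "q ^ 2 / - q = - q" using q by (simp add: power2_eq_square)
    have "qpoch_inf (- (- q)) (q ^ 2) * qpoch_inf (- (q ^ 2 / - q)) (q ^ 2) * qpoch_inf (q ^ 2) (q ^ 2) = J 1 q ^ 2 / J 2 q"
      unfolding quot minus_minus qpoch_inf_odd[OF q(1)] J_def[of 2, symmetric]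
      using J_nonzero[OF q(1), of 2] by (simp add: power2_eq_square)
    then show ?thesis
      using has_sum_imp_sums[OF jacobi_triple_product[OF q2, of "- q"]] q by simp
  qed
  ultimately have GV: "G + (G - g 0) = J 1 q ^ 2 / J 2 q" by (rule sums_unique2)
  have "(\<lambda>r. 2 * g r - (if r = 0 then 1 else 0)) sums (2 * G - 1)"
    using sums_diff[OF sums_mult[OF G, of 2] sums_single[of 0 "\<lambda>_. 1 :: complex"]] by simp
  moreover have "(\<lambda>r. 2 * g r - (if r = 0 then 1 else 0)) = (\<lambda>r. if r = 0 then 1 else 2 * (-1) ^ r * q ^ (r * r))"
    by (auto simp: g_def)
  moreover have "2 * G - 1 = J 1 q ^ 2 / J 2 q"
    using GV by (simp add: g_def)
  ultimately have "(\<lambda>r. if r = 0 then 1 else 2 * (-1) ^ r * q ^ (r * r)) sums (J 1 q ^ 2 / J 2 q)" by simp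
  moreover have "summable (\<lambda>r. norm (if r = 0 then 1 else 2 * (-1) ^ r * q ^ (r * r)))"
    using summable_mult[OF summ_norm, of 2]
    by (rule summable_comparison_test'[where N = 1]) (auto simp: g_def norm_mult)
  ultimately show ?thesis by (intro norm_summable_imp_has_sum)
qed

text \<open>The triple product in base q^6 at x = -q^5. Passing from r to -r-1 in (-1)^r q^(3r^2+2r)
  changes the sign and raises the exponent by 2r+1, whence the factor
  \<open>1 - q ^ (2 * r + 1)\<close>.\<close>

lemma theta_mod_six_has_sum:
  assumes q: "norm q < 1" "q \<noteq> 0"
  shows "((\<lambda>r. (-1) ^ r * q ^ (3 * (r * r) + 2 * r) * (1 - q ^ (2 * r + 1)))
           has_sum (J 1 q * J 6 q ^ 2 / (J 2 q * J 3 q))) UNIV"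
proof -
  have q6: "norm (q ^ 6) < 1" using norm_power_less_1[OF q(1)] by simp
  have jtp: "jtp_term (q ^ 6) (- (q ^ 5)) r = (-1) ^ r * q ^ (3 * (r * r) + 2 * r) * (1 - q ^ (2 * r + 1))" for r
  proof -
    have "6 * (r choose 2) + 5 * r = 3 * (r * r) + 2 * r"
      using choose_two_square[of r] by simp
    then have 1: "(q ^ 6) ^ (r choose 2) * (- (q ^ 5)) ^ r = (-1) ^ r * q ^ (3 * (r * r) + 2 * r)"
      unfolding power_minus[of "q ^ 5"] power_mult [symmetric] by (metis mult.left_commute power_add)
    have "6 * ((r + 2) choose 2) = (3 * (r * r) + 2 * r) + (2 * r + 1) + 5 * (r + 1)"
      using double_choose_two_add_2[of r] by (simp add: algebra_simps)
    then have "(q ^ 6) ^ ((r + 2) choose 2) = q ^ (3 * (r * r) + 2 * r) * q ^ (2 * r + 1) * q ^ (5 * (r + 1))"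
      by (simp only: power_mult [symmetric] power_add)
    then have 2: "(q ^ 6) ^ ((r + 2) choose 2) / (- (q ^ 5)) ^ (r + 1)
        = - ((-1) ^ r * (q ^ (3 * (r * r) + 2 * r) * q ^ (2 * r + 1)))"
      using q unfolding power_minus[of "q ^ 5"] power_mult [symmetric] by (cases "even r") simp_all
    show ?thesis unfolding jtp_term_def 1 2 by (simp add: algebra_simps)
  qed
  have quot: "q ^ 6 / - (q ^ 5) = - q"
    using q by (simp add: power_Suc [symmetric] eval_nat_numeral)
  have "(jtp_term (q ^ 6) (- (q ^ 5)) has_sum (J 1 q * J 6 q ^ 2 / (J 2 q * J 3 q))) UNIV"
    using jacobi_triple_product[OF q6, of "- (q ^ 5)"] q
    unfolding quot minus_minus J_def[of 6, symmetric] qpoch_inf_mod_six[OF q(1)] by simp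
  then show ?thesis unfolding jtp [abs_def] .
qed

subsection \<open>The four Bailey pairs\<close>

lemma double_triple_exponent:
  "2 * triple_exponent i j k = 2 * int i ^ 2 + int j ^ 2 + int k ^ 2 + 2 * int i * int j - 2 * int i * int k - int j - int k"
proof -
  have sq: "2 * int (n choose 2) = int n ^ 2 - int n" for n
    using arg_cong[OF choose_two_square[of n], of int] by (simp add: power2_eq_square)
  show ?thesis
    using sq[of j] sq[of k] by (simp add: triple_exponent_eq power2_eq_square algebra_simps)
qed

lemma prod_add_power:
  fixes p w :: complex
  assumes "w \<noteq> 0"
  shows "(\<Prod>k<n. w + p ^ Suc k) = w ^ n * qpoch (- (p / w)) p n"
  using assms by (induction n) (simp_all add: qpoch_Suc field_simps)

lemma qpoch_shift_quotient: "qpoch a p n * (1 - a * p ^ n) = (1 - a) * qpoch (a * p) p n"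
  using qpoch_Suc[of a p n] qpoch_Suc_shift[of a p n] by simp

context
  fixes q :: complex
  assumes q: "norm q < 1" "q \<noteq> 0"
begin

lemma q_power_nonzero: "1 - q ^ Suc n \<noteq> 0" "1 + q ^ Suc n \<noteq> 0"
  using norm_power_less_1[OF q(1), of "Suc n"] one_minus_nonzero[of "q ^ Suc n"] one_minus_nonzero[of "- (q ^ Suc n)"]
  by (simp_all del: power_Suc)

lemma square_base: "norm (q ^ 2) < 1" "q ^ 2 \<noteq> 0"
  using norm_power_less_1[OF q(1), of 2] q by auto

lemma power_square_Suc: "q ^ (2 * (Suc r * Suc r)) = q ^ (2 * (r * r)) * (q ^ r) ^ 4 * q ^ 2"
proof -
  have "2 * (Suc r * Suc r) = 2 * (r * r) + r * 4 + 2" by simp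
  then show ?thesis by (simp only: power_add power_mult)
qed

lemma power_base_square: "(q ^ 2) ^ r = (q ^ r) ^ 2"
  by (simp add: power_mult [symmetric] mult.commute)

text \<open>All four sequences specialise c^r p^(r^2) (1 - a p^(2r)) (a; p)_r (a/c; p)_r / ((1 - a)
  (p; p)_r (cp; p)_r) with p = q^2. Here a = 1 and c = -1/q, so (a/c; p)_r cancels (cp; p)_r. For a
  = 1 the expression is read as a limit, whose value at r = 0 is 1 and not that of the general
  formula.\<close>

definition alpha1 :: "nat \<Rightarrow> complex" where
  "alpha1 r = (if r = 0 then 1 else (-1) ^ r * q ^ (2 * (r * r)) * (q ^ r + 1 / q ^ r))"

definition alpha2 :: "nat \<Rightarrow> complex" where
  "alpha2 r = (if r = 0 then 1 else 2 * (-1) ^ r * q ^ (2 * (r * r)))"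

definition alpha3 :: "nat \<Rightarrow> complex" where
  "alpha3 r = (-1) ^ r * q ^ (2 * (r * r)) * (1 - q ^ 2 * (q ^ r) ^ 4) / (1 - q ^ 2)"

definition alpha4 :: "nat \<Rightarrow> complex" where
  "alpha4 r = (-1) ^ r * q ^ (2 * (r * r)) * q ^ r * (1 - q * (q ^ r) ^ 2) / (1 - q)"

text \<open>Eliminating \<open>\<delta> (Suc r)\<close> from the two relations forces (1 - a u^2)
  \<delta>(r) = \<alpha>(r) (1 - u)(1 - cu)/u with u = (q^2)^r; all four companions arise in this
  way. For a = 1 this reads 0 = 0 at r = 0, so the value \<delta>(0) = 0 is set by hand. Although c
  = -1/q has modulus above 1, the product formula constrains c q^2 = -q.\<close>

lemma bailey_pair_alpha1:
  "bailey_pair 1 (q ^ 2) alpha1 (\<lambda>n. 1 / (qpoch (q ^ 2) (q ^ 2) n * qpoch (- q) (q ^ 2) n))"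
proof -
  define \<delta> where "\<delta> r = (if r = 0 then 0 else (-1) ^ r * q ^ (2 * (r * r)) / (q ^ r) ^ 3 * (1 + (q ^ r) ^ 2 / q))" for r
  have c: "- (1 / q) * q ^ 2 = - q" using q by (simp add: power2_eq_square)
  have "bailey_pair 1 (q ^ 2) alpha1 (\<lambda>n. 1 / (qpoch (q ^ 2) (q ^ 2) n * qpoch (- (1 / q) * q ^ 2) (q ^ 2) n))"
  proof (rule bailey_pair_product[where \<delta> = \<delta>])
    fix r
    define s where "s = (-1 :: complex) ^ r"
    define t where "t = q ^ r"
    define w where "w = q ^ (2 * (r * r))"
    have t: "t \<noteq> 0" using q by (simp add: t_def)
    have \<delta>_Suc: "\<delta> (Suc r) = - s * w * t * (1 + q * t ^ 2) / q"
      using q t unfolding \<delta>_def power_square_Suc w_def [symmetric] power_Suc[of _ r]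
        t_def [symmetric] s_def [symmetric] by (simp add: field_simps eval_nat_numeral)
    have r0: "s = 1" "t = 1" "w = 1" if "r = 0" using that by (simp_all add: s_def t_def w_def)
    have \<delta>_r: "\<delta> r = s * w / t ^ 3 * (1 + t ^ 2 / q)" and \<alpha>_r: "alpha1 r = s * w * (t + 1 / t)" if "r \<noteq> 0"
      using that by (simp_all add: \<delta>_def alpha1_def s_def t_def w_def)
    show "(q ^ 2) ^ r * (\<delta> (Suc r) - \<delta> r)
        = - alpha1 r * (1 - (1 + - (1 / q)) * (q ^ 2) ^ r + 1 * ((q ^ 2) ^ r) ^ 2)"
    proof (cases "r = 0")
      case True
      then show ?thesis using q
        unfolding \<delta>_Suc by (simp add: r0 alpha1_def \<delta>_def field_simps)
    next
      case False
      show ?thesis using q t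
        unfolding power_base_square t_def [symmetric] \<delta>_Suc \<delta>_r[OF False] \<alpha>_r[OF False]
        by (simp add: field_simps eval_nat_numeral)
    qed
    show "\<delta> (Suc r) - 1 * ((q ^ 2) ^ r) ^ 2 * \<delta> r = alpha1 r * (q ^ 2) ^ r * (- (1 / q) - 1)"
    proof (cases "r = 0")
      case True
      then show ?thesis using q
        unfolding \<delta>_Suc by (simp add: r0 alpha1_def \<delta>_def field_simps)
    next
      case False
      show ?thesis using q t
        unfolding power_base_square t_def [symmetric] \<delta>_Suc \<delta>_r[OF False] \<alpha>_r[OF False]
        by (simp add: field_simps eval_nat_numeral)
    qed
  next
    show "norm (- (1 / q) * q ^ 2) < 1" unfolding c using q by simp
  qed (use q square_base in \<open>auto simp: alpha1_def \<delta>_def\<close>)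
  then show ?thesis unfolding c .
qed

text \<open>The case a = 1, c = -1: here (1 - u)(1 - cu) = 1 - u^2 cancels 1 - a u^2, so the
  companion is \<open>alpha2 r\<close> over (q^2)^r for r > 0.\<close>

lemma bailey_pair_alpha2:
  "bailey_pair 1 (q ^ 2) alpha2 (\<lambda>n. 1 / (qpoch (q ^ 2) (q ^ 2) n * qpoch (- (q ^ 2)) (q ^ 2) n))"
proof -
  define \<delta> where "\<delta> r = (if r = 0 then 0 else 2 * (-1) ^ r * q ^ (2 * (r * r)) / (q ^ r) ^ 2)" for r
  have "bailey_pair 1 (q ^ 2) alpha2 (\<lambda>n. 1 / (qpoch (q ^ 2) (q ^ 2) n * qpoch (- 1 * q ^ 2) (q ^ 2) n))"
  proof (rule bailey_pair_product[where \<delta> = \<delta>])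
    fix r
    define s where "s = (-1 :: complex) ^ r"
    define t where "t = q ^ r"
    define w where "w = q ^ (2 * (r * r))"
    have t: "t \<noteq> 0" using q by (simp add: t_def)
    have \<delta>_Suc: "\<delta> (Suc r) = - 2 * s * w * t ^ 2"
      using q t unfolding \<delta>_def power_square_Suc w_def [symmetric] power_Suc[of _ r]
        t_def [symmetric] s_def [symmetric] by (simp add: field_simps eval_nat_numeral)
    have r0: "s = 1" "t = 1" "w = 1" if "r = 0" using that by (simp_all add: s_def t_def w_def)
    have \<delta>_r: "\<delta> r = 2 * s * w / t ^ 2" and \<alpha>_r: "alpha2 r = 2 * s * w" if "r \<noteq> 0"
      using that by (simp_all add: \<delta>_def alpha2_def s_def t_def w_def)
    show "(q ^ 2) ^ r * (\<delta> (Suc r) - \<delta> r)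
        = - alpha2 r * (1 - (1 + - 1) * (q ^ 2) ^ r + 1 * ((q ^ 2) ^ r) ^ 2)"
    proof (cases "r = 0")
      case True
      then show ?thesis unfolding \<delta>_Suc by (simp add: r0 alpha2_def \<delta>_def)
    next
      case False
      show ?thesis using q t
        unfolding power_base_square t_def [symmetric] \<delta>_Suc \<delta>_r[OF False] \<alpha>_r[OF False]
        by (simp add: field_simps eval_nat_numeral)
    qed
    show "\<delta> (Suc r) - 1 * ((q ^ 2) ^ r) ^ 2 * \<delta> r = alpha2 r * (q ^ 2) ^ r * (- 1 - 1)"
    proof (cases "r = 0")
      case True
      then show ?thesis unfolding \<delta>_Suc by (simp add: r0 alpha2_def \<delta>_def)
    next
      case False
      show ?thesis using q t
        unfolding power_base_square t_def [symmetric] \<delta>_Suc \<delta>_r[OF False] \<alpha>_r[OF False]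
        by (simp add: field_simps eval_nat_numeral)
    qed
  qed (use q square_base in \<open>auto simp: alpha2_def \<delta>_def\<close>)
  then show ?thesis by simp
qed

lemma norm_square_mult_square: "norm (q ^ 2 * q ^ 2) < 1"
  using norm_mult_power_less_1[OF square_base(1) square_base(1), of 1] by simp

text \<open>The case a = q^2, c = -1. Since a differs from 1, the closed form of \<delta> covers r =
  0 as well and vanishes there.\<close>

lemma bailey_pair_alpha3:
  "bailey_pair (q ^ 2) (q ^ 2) alpha3 (\<lambda>n. 1 / (qpoch (q ^ 2) (q ^ 2) n * qpoch (- (q ^ 2)) (q ^ 2) n))"
proof -
  define \<delta> where "\<delta> r = (-1) ^ r * q ^ (2 * (r * r)) / (q ^ r) ^ 2 * (1 - (q ^ r) ^ 4) / (1 - q ^ 2)" for r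
  have nz: "1 - q ^ 2 \<noteq> 0" using q_power_nonzero(1)[of 1] by (simp add: numeral_2_eq_2)
  have "bailey_pair (q ^ 2) (q ^ 2) alpha3 (\<lambda>n. 1 / (qpoch (q ^ 2) (q ^ 2) n * qpoch (- 1 * q ^ 2) (q ^ 2) n))"
  proof (rule bailey_pair_product[where \<delta> = \<delta>])
    fix r
    define s where "s = (-1 :: complex) ^ r"
    define t where "t = q ^ r"
    define w where "w = q ^ (2 * (r * r))"
    define d where "d = 1 - q ^ 2"
    have t: "t \<noteq> 0" and d: "d \<noteq> 0" using q nz by (simp_all add: t_def d_def)
    have \<delta>_Suc: "\<delta> (Suc r) = - s * w * t ^ 2 * (1 - t ^ 4 * q ^ 4) / d"
      using q t d unfolding \<delta>_def power_square_Suc d_def [symmetric] w_def [symmetric] power_Suc[of _ r]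
        t_def [symmetric] s_def [symmetric] by (simp add: field_simps eval_nat_numeral)
    have \<delta>_r: "\<delta> r = s * w / t ^ 2 * (1 - t ^ 4) / d" and \<alpha>_r: "alpha3 r = s * w * (1 - q ^ 2 * t ^ 4) / d"
      by (simp_all add: \<delta>_def alpha3_def s_def t_def w_def d_def)
    show "(q ^ 2) ^ r * (\<delta> (Suc r) - \<delta> r)
        = - alpha3 r * (1 - (1 + - 1) * (q ^ 2) ^ r + q ^ 2 * ((q ^ 2) ^ r) ^ 2)"
      using q t d unfolding power_base_square t_def [symmetric] \<delta>_Suc \<delta>_r \<alpha>_r
      by (simp add: field_simps eval_nat_numeral)
    show "\<delta> (Suc r) - q ^ 2 * ((q ^ 2) ^ r) ^ 2 * \<delta> r = alpha3 r * (q ^ 2) ^ r * (- 1 - q ^ 2)"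
      using q t d unfolding power_base_square t_def [symmetric] \<delta>_Suc \<delta>_r \<alpha>_r
      by (simp add: field_simps eval_nat_numeral)
  qed (use q square_base norm_square_mult_square nz in \<open>auto simp: alpha3_def \<delta>_def\<close>)
  then show ?thesis by simp
qed

text \<open>The case a = q^2, c = -q: the factor 1 - cu = 1 + q u of the companion cancels against 1
  - a u^2 = (1 - q u)(1 + q u).\<close>

lemma bailey_pair_alpha4:
  "bailey_pair (q ^ 2) (q ^ 2) alpha4 (\<lambda>n. 1 / (qpoch (q ^ 2) (q ^ 2) n * qpoch (- (q ^ 3)) (q ^ 2) n))"
proof -
  define \<delta> where "\<delta> r = (-1) ^ r * q ^ (2 * (r * r)) / q ^ r * (1 - (q ^ r) ^ 2) / (1 - q)" for r
  have nz: "1 - q \<noteq> 0" using q_power_nonzero(1)[of 0] by simp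
  have c: "- q * q ^ 2 = - (q ^ 3)" by (simp add: eval_nat_numeral)
  have "bailey_pair (q ^ 2) (q ^ 2) alpha4 (\<lambda>n. 1 / (qpoch (q ^ 2) (q ^ 2) n * qpoch (- q * q ^ 2) (q ^ 2) n))"
  proof (rule bailey_pair_product[where \<delta> = \<delta>])
    fix r
    define s where "s = (-1 :: complex) ^ r"
    define t where "t = q ^ r"
    define w where "w = q ^ (2 * (r * r))"
    define d where "d = 1 - q"
    have t: "t \<noteq> 0" and d: "d \<noteq> 0" using q nz by (simp_all add: t_def d_def)
    have \<delta>_Suc: "\<delta> (Suc r) = - s * w * t ^ 3 * q * (1 - t ^ 2 * q ^ 2) / d"
      using q t d unfolding \<delta>_def power_square_Suc d_def [symmetric] w_def [symmetric] power_Suc[of _ r]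
        t_def [symmetric] s_def [symmetric] by (simp add: field_simps eval_nat_numeral)
    have \<delta>_r: "\<delta> r = s * w / t * (1 - t ^ 2) / d" and \<alpha>_r: "alpha4 r = s * w * t * (1 - q * t ^ 2) / d"
      by (simp_all add: \<delta>_def alpha4_def s_def t_def w_def d_def)
    show "(q ^ 2) ^ r * (\<delta> (Suc r) - \<delta> r)
        = - alpha4 r * (1 - (1 + - q) * (q ^ 2) ^ r + q ^ 2 * ((q ^ 2) ^ r) ^ 2)"
      using q t d unfolding power_base_square t_def [symmetric] \<delta>_Suc \<delta>_r \<alpha>_r
      by (simp add: field_simps eval_nat_numeral)
    show "\<delta> (Suc r) - q ^ 2 * ((q ^ 2) ^ r) ^ 2 * \<delta> r = alpha4 r * (q ^ 2) ^ r * (- q - q ^ 2)"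
      using q t d unfolding power_base_square t_def [symmetric] \<delta>_Suc \<delta>_r \<alpha>_r
      by (simp add: field_simps eval_nat_numeral)
  next
    show "norm (- q * q ^ 2) < 1" unfolding c using norm_power_less_1[OF q(1), of 3] by simp
  qed (use q square_base norm_square_mult_square nz in \<open>auto simp: alpha4_def \<delta>_def\<close>)
  then show ?thesis unfolding c .
qed


section \<open>Boundedness of the four \<open>\<alpha>\<close> sequences\<close>

lemma norm_q_power_le_1: "norm (q ^ n) \<le> 1"
  using q by (simp add: norm_power power_le_one)

lemma alpha1_bounded: "norm (alpha1 r) \<le> 2"
proof (cases "r = 0")
  case False
  \<comment> \<open>The negative power 1/q^r is absorbed by q^(2r^2), so only nonnegative powers of
    q remain.\<close>
  have "r \<le> 2 * (r * r)" by (cases r) auto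
  then have "q ^ (2 * (r * r) - r) = q ^ (2 * (r * r)) * inverse (q ^ r)"
    using q by (simp add: power_diff divide_inverse)
  then have "alpha1 r = (-1) ^ r * (q ^ (2 * (r * r) + r) + q ^ (2 * (r * r) - r))"
    using False by (simp add: alpha1_def power_add distrib_left divide_inverse mult.assoc)
  also have "norm \<dots> \<le> 1 + 1"
    unfolding norm_mult norm_power norm_minus_cancel norm_one power_one mult_1
    by (intro order_trans[OF norm_triangle_ineq] add_mono norm_q_power_le_1)
  finally show ?thesis by simp
qed (simp add: alpha1_def)

lemma alpha2_bounded: "norm (alpha2 r) \<le> 2"
  using norm_q_power_le_1[of "2 * (r * r)"] by (simp add: alpha2_def norm_mult norm_power)

lemma norm_signed_mult_diff_le:
  "norm ((-1) ^ r * q ^ m * (1 - q ^ n) / d) \<le> 2 / norm d"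
proof -
  have "norm (q ^ m) * norm (1 - q ^ n) \<le> 1 * (1 + 1)"
    using norm_q_power_le_1[of n] norm_q_power_le_1[of m] norm_triangle_ineq4[of 1 "q ^ n"]
    by (intro mult_mono) auto
  then show ?thesis
    by (simp add: norm_mult norm_divide norm_power divide_right_mono)
qed

lemma alpha3_bounded: "norm (alpha3 r) \<le> 2 / norm (1 - q ^ 2)"
proof -
  have "q ^ 2 * (q ^ r) ^ 4 = q ^ (2 + r * 4)" by (simp only: power_add power_mult)
  then show ?thesis unfolding alpha3_def by (simp only: norm_signed_mult_diff_le)
qed

lemma alpha4_bounded: "norm (alpha4 r) \<le> 2 / norm (1 - q)"
proof -
  have 1: "q * (q ^ r) ^ 2 = q ^ (1 + r * 2)"
    and 2: "(-1) ^ r * q ^ (2 * (r * r)) * q ^ r = (-1) ^ r * q ^ (2 * (r * r) + r)"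
    by (simp_all only: power_add power_mult power_one_right mult.assoc)
  show ?thesis unfolding alpha4_def 1 2 by (rule norm_signed_mult_diff_le)
qed

subsection \<open>The identities for nonzero \<open>q\<close>\<close>

text \<open>Passage to base q^2 with U = q^a, V = q^b, W = q^c. As twice the common form already
  contains -j - k, the values of b and c are the coefficients of j and k in the given exponent plus
  1.\<close>

lemma powi_triple_exponent:
  "q powi (2 * triple_exponent i j k + int a * int i + int b * int j + int c * int k)
   = (q ^ a) ^ i * (q ^ b) ^ j * (q ^ c) ^ k * (q ^ 2) powi triple_exponent i j k"
proof -
  have "q powi (int m * int n) = (q ^ m) ^ n" for m n
    by (metis of_nat_mult power_int_of_nat power_mult)
  moreover have "q powi (2 * triple_exponent i j k) = (q ^ 2) powi triple_exponent i j k"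
    by (simp add: power_int_power)
  ultimately show ?thesis
    using q by (simp add: power_int_add del: of_nat_mult)
qed

lemma qpoch_inf_minus_square: "qpoch_inf (- (q ^ 2)) (q ^ 2) = J 4 q / J 2 q"
  using qpoch_inf_minus_base[OF square_base(1)] by (simp add: J_power)

lemma qpoch_inf_square_shift: "qpoch_inf (q ^ 2 * q ^ 2) (q ^ 2) = J 2 q / (1 - q ^ 2)"
proof -
  have "1 - q ^ 2 \<noteq> 0" using q_power_nonzero(1)[of 1] by (simp add: numeral_2_eq_2)
  then show ?thesis
    using qpoch_inf_shift_1[OF square_base(1), of "q ^ 2"] by (simp add: J_def)
qed

lemma qpoch_inf_minus_cube: "qpoch_inf (- (q ^ 3)) (q ^ 2) = J 2 q ^ 2 / (J 1 q * J 4 q) / (1 + q)"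
proof -
  have "1 + q \<noteq> 0" using q_power_nonzero(2)[of 0] by simp
  moreover have "- q * q ^ 2 = - (q ^ 3)" by (simp add: eval_nat_numeral)
  ultimately show ?thesis
    using qpoch_inf_shift_1[OF square_base(1), of "- q"] qpoch_inf_minus_odd[OF q(1)] by (simp add: field_simps)
qed

lemma theta_cube_has_sum:
  "((\<lambda>r. if r = 0 then 1 else 2 * (-1) ^ r * (q ^ 3) ^ (r * r)) has_sum (J 3 q ^ 2 / J 6 q)) UNIV"
  using theta_square_has_sum[of "q ^ 3"] norm_power_less_1[OF q(1), of 3] q by (simp add: J_power)

text \<open>Here (U, V, W) = (1, q, q^2). The product over k is q^(2r) (-1; q^2)_r; divided by
  (-q^2; q^2)_r it leaves 2/(1 + q^(2r)) for r > 0, and this denominator cancels the factor q^r +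
  q^(-r) of \<open>alpha1\<close> up to a power of q.\<close>

lemma triple_sum_identity2:
  "((\<lambda>(i::nat, j::nat, k::nat).
       q powi (2 * int i ^ 2 + int j ^ 2 + int k ^ 2 + 2 * int i * int j - 2 * int i * int k + int k)
       / (qpoch (q^2) (q^2) i * qpoch (q^2) (q^2) j * qpoch (q^2) (q^2) k))
     has_sum (J 3 q ^ 2 * J 4 q / (J 1 q * J 2 q * J 6 q))) UNIV"
proof -
  have ex: "q powi (2 * int i ^ 2 + int j ^ 2 + int k ^ 2 + 2 * int i * int j - 2 * int i * int k + int k)
      = 1 ^ i * q ^ j * (q ^ 2) ^ k * (q ^ 2) powi triple_exponent i j k" for i j k
    using powi_triple_exponent[where i = i and j = j and k = k and a = 0 and b = 1 and c = 2]
    unfolding double_triple_exponent by (simp add: algebra_simps)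
  have T: "1 ^ r * (q ^ 2) ^ (r choose 2) * (\<Prod>k<r. q ^ 2 + (q ^ 2) ^ Suc k) / qpoch (- (1 * q ^ 2)) (q ^ 2) r * alpha1 r
      = (if r = 0 then 1 else 2 * (-1) ^ r * (q ^ 3) ^ (r * r))" for r
  proof (cases "r = 0")
    case False
    define t X w s Q where defs: "t = q ^ r" "X = q ^ (r * r)" "w = q ^ (2 * (r * r))" "s = (-1 :: complex) ^ r"
      "Q = qpoch (- (q ^ 2)) (q ^ 2) r"
    define d where "d = 1 + t ^ 2"
    have t: "t \<noteq> 0" "d \<noteq> 0"
      using q q_power_nonzero(2)[of "2 * r - 1"] False by (simp_all add: d_def defs power_mult [symmetric] mult.commute flip: power_Suc)
    have Q: "Q \<noteq> 0" unfolding defs using square_base by (intro qpoch_nonzero) auto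
    have "qpoch (- 1) (q ^ 2) r = 2 * Q / d"
      using qpoch_shift_quotient[of "- 1" "q ^ 2" r] t by (simp add: power_base_square d_def defs field_simps)
    then have P: "(\<Prod>k<r. q ^ 2 + (q ^ 2) ^ Suc k) = t ^ 2 * (2 * Q / d)"
      using prod_add_power[OF square_base(2), of "q ^ 2" r] square_base by (simp add: power_base_square defs)
    have C: "(q ^ 2) ^ (r choose 2) = X / t"
      unfolding defs by (rule square_power_choose_two[OF q(2)])
    have E: "(q ^ 3) ^ (r * r) = X * w"
      unfolding defs by (simp add: power_mult [symmetric] power_add [symmetric])
    have A: "alpha1 r = s * w * (d / t)"
      using False t by (simp add: alpha1_def d_def defs add_divide_distrib power2_eq_square add.commute)
    show ?thesis
      unfolding C P E A mult_1 defs(5) [symmetric] defs(4) [symmetric] if_not_P[OF False] power_one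
      using t Q by (simp add: power2_eq_square)
  qed (simp add: alpha1_def)
  have "((\<lambda>(i, j, k). 1 ^ i * q ^ j * (q ^ 2) ^ k * (q ^ 2) powi triple_exponent i j k
      / (qpoch (q ^ 2) (q ^ 2) i * qpoch (q ^ 2) (q ^ 2) j * qpoch (q ^ 2) (q ^ 2) k))
      has_sum (qpoch_inf (- q) (q ^ 2) * qpoch_inf (- (q ^ 2)) (q ^ 2) * qpoch_inf (- (1 * q ^ 2)) (q ^ 2)
        / qpoch_inf (1 * q ^ 2) (q ^ 2) * (J 3 q ^ 2 / J 6 q))) UNIV"
    by (rule triple_bailey[OF square_base _ _ _ _ bailey_pair_alpha1 alpha1_bounded theta_cube_has_sum[folded T]])
      (use q square_base in auto)
  moreover have "qpoch_inf (- q) (q ^ 2) * qpoch_inf (- (q ^ 2)) (q ^ 2) * qpoch_inf (- (1 * q ^ 2)) (q ^ 2)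
        / qpoch_inf (1 * q ^ 2) (q ^ 2) * (J 3 q ^ 2 / J 6 q) = J 3 q ^ 2 * J 4 q / (J 1 q * J 2 q * J 6 q)"
    unfolding mult_1 qpoch_inf_minus_odd[OF q(1)] qpoch_inf_minus_square J_def[of 2, symmetric]
    using J_nonzero[OF q(1)] by (simp add: field_simps power2_eq_square)
  ultimately show ?thesis unfolding ex by (simp only:)
qed

text \<open>Here (U, V, W) = (1, q^2, q). The product over k is q^r (-q; q^2)_r, whose shifted
  factorial cancels the denominator entirely.\<close>

lemma triple_sum_identity3:
  "((\<lambda>(i::nat, j::nat, k::nat).
       q powi (2 * int i ^ 2 + int j ^ 2 + int k ^ 2 + 2 * int i * int j - 2 * int i * int k + int j)
       / (qpoch (q^2) (q^2) i * qpoch (q^2) (q^2) j * qpoch (q^2) (q^2) k))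
     has_sum (J 2 q ^ 2 * J 3 q ^ 2 / (J 1 q ^ 2 * J 4 q * J 6 q))) UNIV"
proof -
  have ex: "q powi (2 * int i ^ 2 + int j ^ 2 + int k ^ 2 + 2 * int i * int j - 2 * int i * int k + int j)
      = 1 ^ i * (q ^ 2) ^ j * q ^ k * (q ^ 2) powi triple_exponent i j k" for i j k
    using powi_triple_exponent[where i = i and j = j and k = k and a = 0 and b = 2 and c = 1]
    unfolding double_triple_exponent by (simp add: algebra_simps)
  have T: "1 ^ r * (q ^ 2) ^ (r choose 2) * (\<Prod>k<r. q + (q ^ 2) ^ Suc k) / qpoch (- (1 * q)) (q ^ 2) r * alpha2 r
      = (if r = 0 then 1 else 2 * (-1) ^ r * (q ^ 3) ^ (r * r))" for r
  proof (cases "r = 0")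
    case False
    define t X w s Q where defs: "t = q ^ r" "X = q ^ (r * r)" "w = q ^ (2 * (r * r))" "s = (-1 :: complex) ^ r"
      "Q = qpoch (- q) (q ^ 2) r"
    have t: "t \<noteq> 0" using q by (simp add: defs)
    have Q: "Q \<noteq> 0" unfolding defs using q square_base by (intro qpoch_nonzero) auto
    have "q ^ 2 / q = q" using q by (simp add: power2_eq_square)
    then have P: "(\<Prod>k<r. q + (q ^ 2) ^ Suc k) = t * Q"
      using prod_add_power[OF q(2), of "q ^ 2" r] by (simp add: defs)
    have C: "(q ^ 2) ^ (r choose 2) = X / t"
      unfolding defs by (rule square_power_choose_two[OF q(2)])
    have E: "(q ^ 3) ^ (r * r) = X * w"
      unfolding defs by (simp add: power_mult [symmetric] power_add [symmetric])
    have A: "alpha2 r = 2 * s * w" using False by (simp add: alpha2_def defs)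
    show ?thesis
      unfolding C P E A mult_1 defs(5) [symmetric] defs(4) [symmetric] if_not_P[OF False] power_one
      using t Q by simp
  qed (simp add: alpha2_def)
  have "((\<lambda>(i, j, k). 1 ^ i * (q ^ 2) ^ j * q ^ k * (q ^ 2) powi triple_exponent i j k
      / (qpoch (q ^ 2) (q ^ 2) i * qpoch (q ^ 2) (q ^ 2) j * qpoch (q ^ 2) (q ^ 2) k))
      has_sum (qpoch_inf (- (q ^ 2)) (q ^ 2) * qpoch_inf (- q) (q ^ 2) * qpoch_inf (- (1 * q)) (q ^ 2)
        / qpoch_inf (1 * q ^ 2) (q ^ 2) * (J 3 q ^ 2 / J 6 q))) UNIV"
    by (rule triple_bailey[OF square_base _ _ _ _ bailey_pair_alpha2 alpha2_bounded theta_cube_has_sum[folded T]])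
      (use q square_base in auto)
  moreover have "qpoch_inf (- (q ^ 2)) (q ^ 2) * qpoch_inf (- q) (q ^ 2) * qpoch_inf (- (1 * q)) (q ^ 2)
        / qpoch_inf (1 * q ^ 2) (q ^ 2) * (J 3 q ^ 2 / J 6 q) = J 2 q ^ 2 * J 3 q ^ 2 / (J 1 q ^ 2 * J 4 q * J 6 q)"
    unfolding mult_1 qpoch_inf_minus_odd[OF q(1)] qpoch_inf_minus_square J_def[of 2, symmetric]
    using J_nonzero[OF q(1)] by (simp add: field_simps power2_eq_square)
  ultimately show ?thesis unfolding ex by (simp only:)
qed

text \<open>Here (U, V, W) = (q^2, q^2, q). The quotient (-q; q^2)_r / (-q^3; q^2)_r is (1 + q)/(1 +
  q^(2r+1)), and its denominator cancels one factor of 1 - q^(4r+2) in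
  \<open>alpha3\<close>.\<close>

lemma triple_sum_identity4:
  "((\<lambda>(i::nat, j::nat, k::nat).
       q powi (2 * int i ^ 2 + int j ^ 2 + int k ^ 2 + 2 * int i * int j - 2 * int i * int k
               + 2 * int i + int j)
       / (qpoch (q^2) (q^2) i * qpoch (q^2) (q^2) j * qpoch (q^2) (q^2) k))
     has_sum (J 2 q * J 6 q ^ 2 / (J 1 q * J 3 q * J 4 q))) UNIV"
proof -
  have ex: "q powi (2 * int i ^ 2 + int j ^ 2 + int k ^ 2 + 2 * int i * int j - 2 * int i * int k
               + 2 * int i + int j)
      = (q ^ 2) ^ i * (q ^ 2) ^ j * q ^ k * (q ^ 2) powi triple_exponent i j k" for i j k
    using powi_triple_exponent[where i = i and j = j and k = k and a = 2 and b = 2 and c = 1]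
    unfolding double_triple_exponent by (simp add: algebra_simps)
  have nz: "1 - q \<noteq> 0" "1 + q \<noteq> 0" "1 - q ^ 2 \<noteq> 0"
    using q_power_nonzero[of 0] q_power_nonzero(1)[of 1] by (simp_all add: numeral_2_eq_2)
  have factor: "1 - q ^ 2 = (1 - q) * (1 + q)" by (simp add: algebra_simps power2_eq_square)
  have T: "(q ^ 2) ^ r * (q ^ 2) ^ (r choose 2) * (\<Prod>k<r. q + (q ^ 2) ^ Suc k) / qpoch (- (q ^ 2 * q)) (q ^ 2) r * alpha3 r
      = 1 / (1 - q) * ((-1) ^ r * q ^ (3 * (r * r) + 2 * r) * (1 - q ^ (2 * r + 1)))" for r
  proof -
    define t X w s Q where defs: "t = q ^ r" "X = q ^ (r * r)" "w = q ^ (2 * (r * r))" "s = (-1 :: complex) ^ r"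
      "Q = qpoch (- (q ^ 2 * q)) (q ^ 2) r"
    define d where "d = 1 + q * t ^ 2"
    have t: "t \<noteq> 0" and d: "d \<noteq> 0"
      using q q_power_nonzero(2)[of "2 * r"] by (simp_all add: d_def defs power_mult [symmetric] mult.commute)
    have Q: "Q \<noteq> 0"
      unfolding defs using norm_mult_power_less_1[OF q(1) q(1), of 2] square_base
      by (intro qpoch_nonzero) (simp_all add: mult.commute)
    have "qpoch (- q) (q ^ 2) r = (1 + q) * Q / d"
      using qpoch_shift_quotient[of "- q" "q ^ 2" r] d by (simp add: power_base_square d_def defs field_simps)
    moreover have "q ^ 2 / q = q" using q by (simp add: power2_eq_square)
    ultimately have P: "(\<Prod>k<r. q + (q ^ 2) ^ Suc k) = t * ((1 + q) * Q / d)"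
      using prod_add_power[OF q(2), of "q ^ 2" r] by (simp add: defs)
    have C: "(q ^ 2) ^ (r choose 2) = X / t"
      unfolding defs by (rule square_power_choose_two[OF q(2)])
    have p1: "q ^ (3 * (r * r) + 2 * r) = X * w * t ^ 2"
      unfolding defs power_mult [symmetric] power_add [symmetric] by (simp add: mult.commute)
    have p2: "q ^ (2 * r + 1) = q * t ^ 2"
      unfolding defs power_mult [symmetric] by (simp add: mult.commute)
    have "1 - q ^ 2 * t ^ 4 = (1 - q * t ^ 2) * d"
      by (simp add: d_def algebra_simps eval_nat_numeral)
    then have A: "alpha3 r = s * w * ((1 - q * t ^ 2) * d) / ((1 - q) * (1 + q))"
      unfolding alpha3_def factor by (simp add: defs)
    show ?thesis
      unfolding C P A p1 p2 power_base_square[of r] defs(5) [symmetric] defs(4) [symmetric] defs(1) [symmetric]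
      using t Q d nz by (simp add: power2_eq_square)
  qed
  have "((\<lambda>(i, j, k). (q ^ 2) ^ i * (q ^ 2) ^ j * q ^ k * (q ^ 2) powi triple_exponent i j k
      / (qpoch (q ^ 2) (q ^ 2) i * qpoch (q ^ 2) (q ^ 2) j * qpoch (q ^ 2) (q ^ 2) k))
      has_sum (qpoch_inf (- (q ^ 2)) (q ^ 2) * qpoch_inf (- q) (q ^ 2) * qpoch_inf (- (q ^ 2 * q)) (q ^ 2)
        / qpoch_inf (q ^ 2 * q ^ 2) (q ^ 2) * (1 / (1 - q) * (J 1 q * J 6 q ^ 2 / (J 2 q * J 3 q))))) UNIV"
  proof (rule triple_bailey[OF square_base _ _ _ _ bailey_pair_alpha3 alpha3_bounded
        has_sum_cmult_right[OF theta_mod_six_has_sum[OF q], of "1 / (1 - q)", folded T]])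
    show "norm (q ^ 2 * q) < 1"
      using norm_mult_power_less_1[OF q(1) q(1), of 2] by (simp add: mult.commute)
  qed (use q square_base in auto)
  moreover have "qpoch_inf (- (q ^ 2)) (q ^ 2) * qpoch_inf (- q) (q ^ 2) * qpoch_inf (- (q ^ 2 * q)) (q ^ 2)
        / qpoch_inf (q ^ 2 * q ^ 2) (q ^ 2) * (1 / (1 - q) * (J 1 q * J 6 q ^ 2 / (J 2 q * J 3 q)))
      = J 2 q * J 6 q ^ 2 / (J 1 q * J 3 q * J 4 q)"
  proof -
    have cube: "q ^ 2 * q = q ^ 3" by (simp add: eval_nat_numeral)
    show ?thesis
      unfolding cube qpoch_inf_minus_odd[OF q(1)] qpoch_inf_minus_square qpoch_inf_minus_cube qpoch_inf_square_shift factor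
      using J_nonzero[OF q(1)] nz by (simp add: power2_eq_square)
  qed
  ultimately show ?thesis unfolding ex by (simp only:)
qed

text \<open>Here (U, V, W) = (q^2, q^3, 1), and the product over k equals the denominator (-q^2;
  q^2)_r. The bound needed on UW is strict although W = 1, because |U| < 1.\<close>

lemma triple_sum_identity5:
  "((\<lambda>(i::nat, j::nat, k::nat).
       q powi (2 * int i ^ 2 + int j ^ 2 + int k ^ 2 + 2 * int i * int j - 2 * int i * int k
               + 2 * int i + 2 * int j - int k)
       / (qpoch (q^2) (q^2) i * qpoch (q^2) (q^2) j * qpoch (q^2) (q^2) k))
     has_sum (2 * J 4 q * J 6 q ^ 2 / (J 2 q ^ 2 * J 3 q))) UNIV"
proof -
  have ex: "q powi (2 * int i ^ 2 + int j ^ 2 + int k ^ 2 + 2 * int i * int j - 2 * int i * int k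
               + 2 * int i + 2 * int j - int k)
      = (q ^ 2) ^ i * (q ^ 3) ^ j * 1 ^ k * (q ^ 2) powi triple_exponent i j k" for i j k
    using powi_triple_exponent[where i = i and j = j and k = k and a = 2 and b = 3 and c = 0]
    unfolding double_triple_exponent by (simp add: algebra_simps)
  have nz: "1 - q \<noteq> 0" "1 + q \<noteq> 0" "1 - q ^ 2 \<noteq> 0"
    using q_power_nonzero[of 0] q_power_nonzero(1)[of 1] by (simp_all add: numeral_2_eq_2)
  have factor: "1 - q ^ 2 = (1 - q) * (1 + q)" by (simp add: algebra_simps power2_eq_square)
  have T: "(q ^ 2) ^ r * (q ^ 2) ^ (r choose 2) * (\<Prod>k<r. 1 + (q ^ 2) ^ Suc k) / qpoch (- (q ^ 2 * 1)) (q ^ 2) r * alpha4 r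
      = 1 / (1 - q) * ((-1) ^ r * q ^ (3 * (r * r) + 2 * r) * (1 - q ^ (2 * r + 1)))" for r
  proof -
    define t X w s Q where defs: "t = q ^ r" "X = q ^ (r * r)" "w = q ^ (2 * (r * r))" "s = (-1 :: complex) ^ r"
      "Q = qpoch (- (q ^ 2)) (q ^ 2) r"
    have t: "t \<noteq> 0" using q by (simp add: defs)
    have Q: "Q \<noteq> 0" unfolding defs using square_base by (intro qpoch_nonzero) auto
    have P: "(\<Prod>k<r. 1 + (q ^ 2) ^ Suc k) = Q"
      using prod_add_power[of 1 "q ^ 2" r] by (simp add: defs)
    have C: "(q ^ 2) ^ (r choose 2) = X / t"
      unfolding defs by (rule square_power_choose_two[OF q(2)])
    have p1: "q ^ (3 * (r * r) + 2 * r) = X * w * t ^ 2"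
      unfolding defs power_mult [symmetric] power_add [symmetric] by (simp add: mult.commute)
    have p2: "q ^ (2 * r + 1) = q * t ^ 2"
      unfolding defs power_mult [symmetric] by (simp add: mult.commute)
    have A: "alpha4 r = s * w * t * (1 - q * t ^ 2) / (1 - q)"
      by (simp add: alpha4_def defs)
    show ?thesis
      unfolding C P A p1 p2 power_base_square[of r] mult_1_right defs(5) [symmetric] defs(4) [symmetric] defs(1) [symmetric]
      using t Q nz by (simp add: power2_eq_square)
  qed
  have "((\<lambda>(i, j, k). (q ^ 2) ^ i * (q ^ 3) ^ j * 1 ^ k * (q ^ 2) powi triple_exponent i j k
      / (qpoch (q ^ 2) (q ^ 2) i * qpoch (q ^ 2) (q ^ 2) j * qpoch (q ^ 2) (q ^ 2) k))
      has_sum (qpoch_inf (- (q ^ 3)) (q ^ 2) * qpoch_inf (- 1) (q ^ 2) * qpoch_inf (- (q ^ 2 * 1)) (q ^ 2)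
        / qpoch_inf (q ^ 2 * q ^ 2) (q ^ 2) * (1 / (1 - q) * (J 1 q * J 6 q ^ 2 / (J 2 q * J 3 q))))) UNIV"
  proof (rule triple_bailey[OF square_base _ _ _ _ bailey_pair_alpha4 alpha4_bounded
        has_sum_cmult_right[OF theta_mod_six_has_sum[OF q], of "1 / (1 - q)", folded T]])
    show "norm (q ^ 3) < 1" using norm_power_less_1[OF q(1), of 3] by simp
  qed (use q square_base in auto)
  moreover have "qpoch_inf (- (q ^ 3)) (q ^ 2) * qpoch_inf (- 1) (q ^ 2) * qpoch_inf (- (q ^ 2 * 1)) (q ^ 2)
        / qpoch_inf (q ^ 2 * q ^ 2) (q ^ 2) * (1 / (1 - q) * (J 1 q * J 6 q ^ 2 / (J 2 q * J 3 q)))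
      = 2 * J 4 q * J 6 q ^ 2 / (J 2 q ^ 2 * J 3 q)"
  proof -
    \<comment> \<open>The leading factor 1 + 1 of (-1; q^2)_\<infinity> is the origin of the 2 on
      the right-hand side.\<close>
    have one: "qpoch_inf (- 1) (q ^ 2) = 2 * (J 4 q / J 2 q)"
      using qpoch_inf_shift_1[OF square_base(1), of "- 1"] qpoch_inf_minus_square by simp
    show ?thesis
      unfolding mult_1_right one qpoch_inf_minus_square qpoch_inf_minus_cube qpoch_inf_square_shift factor
      using J_nonzero[OF q(1)] nz by (simp add: power2_eq_square mult_ac)
  qed
  ultimately show ?thesis unfolding ex by (simp only:)
qed

text \<open>With U = V = W = 1 the factors of the single series combine to (1 + q^i) (-q;
  q)_\<infinity>, so it splits into Euler sums at x = 1 and x = q, equal to 2M and M. With the outer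
  factor (-1; q)_\<infinity> = 2M this gives 6 = 2 (2 + 1).\<close>

lemma triple_sum_identity1:
  "((\<lambda>(i::nat, j::nat, k::nat).
       q powi (int i ^ 2 + int i * int j - int i * int k
               + (int j ^ 2 - int j) div 2 + (int k ^ 2 - int k) div 2)
       / (qpoch q q i * qpoch q q j * qpoch q q k))
     has_sum (6 * J 2 q ^ 3 / J 1 q ^ 3)) UNIV"
proof -
  define M where "M = J 2 q / J 1 q"
  have M: "qpoch_inf (- q) q = M" "qpoch_inf (- 1) q = 2 * M"
    using qpoch_inf_minus_base[OF q(1)] qpoch_inf_shift_1[OF q(1), of "- 1"] by (simp_all add: M_def)
  have term_eq: "1 ^ i * q ^ (i choose 2) * (\<Prod>m<i. 1 + q ^ Suc m) / qpoch q q i * qpoch_inf (- 1 * q ^ i) q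
      = M * (q ^ (i choose 2) * 1 ^ i / qpoch q q i) + M * (q ^ (i choose 2) * q ^ i / qpoch q q i)" for i
  proof -
    have "qpoch (- q) q i * qpoch_inf (- 1 * q ^ i) q = (1 + q ^ i) * M"
      unfolding M(1) [symmetric] qpoch_inf_shift_1[OF q(1), of "- 1 * q ^ i"] qpoch_inf_shift[OF q(1), of "- q" i]
      by (simp add: mult_ac)
    moreover have "(\<Prod>m<i. 1 + q ^ Suc m) = qpoch (- q) q i"
      using prod_add_power[of 1 q i] by simp
    ultimately have 1: "(\<Prod>m<i. 1 + q ^ Suc m) * qpoch_inf (- 1 * q ^ i) q = (1 + q ^ i) * M" by simp
    have 2: "1 ^ i * x * y / z * w = x * (y * w) / z" for x y z w :: complex by simp
    show ?thesis unfolding 2 1 by (simp add: algebra_simps add_divide_distrib)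
  qed
  have "((\<lambda>i. 1 ^ i * q ^ (i choose 2) * (\<Prod>m<i. 1 + q ^ Suc m) / qpoch q q i * qpoch_inf (- 1 * q ^ i) q)
      has_sum (M * qpoch_inf (- 1) q + M * qpoch_inf (- q) q)) UNIV"
    unfolding term_eq by (intro has_sum_add has_sum_cmult_right euler_has_sum q)
  from triple_has_sum[OF q _ _ _ this]
  have "((\<lambda>(i, j, k). 1 ^ i * 1 ^ j * 1 ^ k * q powi triple_exponent i j k
            / (qpoch q q i * qpoch q q j * qpoch q q k))
      has_sum (2 * M * (M * (2 * M) + M * M))) UNIV"
    by (simp only: M norm_one order_refl)
  moreover have "2 * M * (M * (2 * M) + M * M) = 6 * J 2 q ^ 3 / J 1 q ^ 3"
  proof -
    have "2 * M * (M * (2 * M) + M * M) = 6 * M ^ 3"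
      by (simp add: power3_eq_cube algebra_simps)
    then show ?thesis by (simp add: M_def power_divide)
  qed
  ultimately show ?thesis
    unfolding triple_exponent_def power_one mult_1 by simp
qed

end

subsection \<open>The case \<open>q = 0\<close>\<close>

text \<open>Here \<open>0 powi e\<close> is \<open>1\<close> for \<open>e = 0\<close> and \<open>0\<close> otherwise, so each series counts the zeros of its exponent.\<close>

lemma has_sum_zero_powi:
  fixes e :: "nat \<times> nat \<times> nat \<Rightarrow> int"
  assumes "finite B" "\<And>x. e x = 0 \<longleftrightarrow> x \<in> B"
  shows "((\<lambda>x. (0 :: complex) powi e x) has_sum of_nat (card B)) UNIV"
proof (rule has_sum_finite_neutralI[OF assms(1)])
  have "(\<Sum>x\<in>B. (0 :: complex) powi e x) = (\<Sum>x\<in>B. 1)"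
    by (rule sum.cong) (use assms in \<open>auto simp: power_int_0_left_if\<close>)
  then show "of_nat (card B) = (\<Sum>x\<in>B. (0 :: complex) powi e x)" by simp
qed (use assms in \<open>auto simp: power_int_0_left_if\<close>)

lemma int_square_minus_nonneg: "0 \<le> (n::int) * n - n"
  by (cases "n \<le> 0") (auto simp: mult_le_cancel_left1 zero_le_mult_iff algebra_simps)

lemma int_square_minus_zero_iff: "(n::int) * n - n = 0 \<longleftrightarrow> n = 0 \<or> n = 1"
  by auto

lemma J_zero: "m > 0 \<Longrightarrow> J m 0 = 1"
  by (simp add: J_def power_0_left)

text \<open>Twice the exponent is i(i-1) + j(j-1) + 2ij + (k-i)(k-i-1), a sum of nonnegative
  integers, so each summand must vanish. The six solutions account for the value 6 at q = 0.\<close>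

lemma exponent1_zero_iff:
  "int i ^ 2 + int i * int j - int i * int k + (int j ^ 2 - int j) div 2 + (int k ^ 2 - int k) div 2 = 0
   \<longleftrightarrow> (i, j, k) \<in> {(0,0,0), (0,0,1), (0,1,0), (0,1,1), (1,0,1), (1,0,2)}"
proof
  assume "int i ^ 2 + int i * int j - int i * int k + (int j ^ 2 - int j) div 2 + (int k ^ 2 - int k) div 2 = 0"
  then have "2 * triple_exponent i j k = 0" by (simp add: triple_exponent_def)
  then have eq: "(int i * int i - int i) + (int j * int j - int j) + 2 * (int i * int j)
      + ((int k - int i) * (int k - int i) - (int k - int i)) = 0"
    unfolding double_triple_exponent by (simp add: power2_eq_square algebra_simps)
  have nonneg: "0 \<le> int i * int j" by simp
  have "int i * int i - int i = 0" "int j * int j - int j = 0" "int i * int j = 0"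
    "(int k - int i) * (int k - int i) - (int k - int i) = 0"
    using eq nonneg int_square_minus_nonneg[of "int i"] int_square_minus_nonneg[of "int j"]
      int_square_minus_nonneg[of "int k - int i"] by linarith+
  then show "(i, j, k) \<in> {(0,0,0), (0,0,1), (0,1,0), (0,1,1), (1,0,1), (1,0,2)}"
    unfolding int_square_minus_zero_iff by auto
qed auto

text \<open>The quadratic part is i^2 + j^2 + (k-i)^2 + 2ij. The nonnegative \<open>a\<close> stands
  for the linear terms of the second, third and fourth exponents.\<close>

lemma exponent_zero_iff:
  assumes "a \<ge> 0"
  shows "2 * int i ^ 2 + int j ^ 2 + int k ^ 2 + 2 * int i * int j - 2 * int i * int k + a = 0
   \<longleftrightarrow> (i, j, k) = (0, 0, 0) \<and> a = 0"
proof
  assume "2 * int i ^ 2 + int j ^ 2 + int k ^ 2 + 2 * int i * int j - 2 * int i * int k + a = 0"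
  then have eq: "int i * int i + int j * int j + (int k - int i) * (int k - int i) + 2 * (int i * int j) + a = 0"
    by (simp add: power2_eq_square algebra_simps)
  have "0 \<le> int i * int j" "0 \<le> int i * int i" "0 \<le> int j * int j" "0 \<le> (int k - int i) * (int k - int i)"
    by auto
  then have "int i * int i = 0" "int j * int j = 0" "(int k - int i) * (int k - int i) = 0" "a = 0"
    using eq assms by linarith+
  then show "(i, j, k) = (0, 0, 0) \<and> a = 0" by auto
qed auto

text \<open>The negative term is distributed as 2i - k = i - (k-i), and (k-i)^2 - (k-i) is
  nonnegative on integers. Its second root k - i = 1 yields the second solution.\<close>

lemma exponent5_zero_iff:
  "2 * int i ^ 2 + int j ^ 2 + int k ^ 2 + 2 * int i * int j - 2 * int i * int k + 2 * int i + 2 * int j - int k = 0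
   \<longleftrightarrow> (i, j, k) \<in> {(0,0,0), (0,0,1)}"
proof
  assume "2 * int i ^ 2 + int j ^ 2 + int k ^ 2 + 2 * int i * int j - 2 * int i * int k + 2 * int i + 2 * int j - int k = 0"
  then have eq: "int i * int i + int i + int j * int j + 2 * int j + 2 * (int i * int j)
      + ((int k - int i) * (int k - int i) - (int k - int i)) = 0"
    by (simp add: power2_eq_square algebra_simps)
  have "0 \<le> int i * int j" "0 \<le> int i * int i" "0 \<le> int j * int j" "0 \<le> int i" "0 \<le> int j"
    by auto
  then have "int i = 0" "int j = 0" "(int k - int i) * (int k - int i) - (int k - int i) = 0"
    using eq int_square_minus_nonneg[of "int k - int i"] by linarith+
  then show "(i, j, k) \<in> {(0,0,0), (0,0,1)}"
    unfolding int_square_minus_zero_iff by auto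
qed auto

theorem theorem4p4:
  fixes q :: complex
  assumes "norm q < 1"
  shows
   "((\<lambda>(i::nat, j::nat, k::nat).
       q powi (int i ^ 2 + int i * int j - int i * int k
               + (int j ^ 2 - int j) div 2 + (int k ^ 2 - int k) div 2)
       / (qpoch q q i * qpoch q q j * qpoch q q k))
     has_sum (6 * J 2 q ^ 3 / J 1 q ^ 3)) UNIV \<and>
    ((\<lambda>(i::nat, j::nat, k::nat).
       q powi (2 * int i ^ 2 + int j ^ 2 + int k ^ 2 + 2 * int i * int j - 2 * int i * int k + int k)
       / (qpoch (q^2) (q^2) i * qpoch (q^2) (q^2) j * qpoch (q^2) (q^2) k))
     has_sum (J 3 q ^ 2 * J 4 q / (J 1 q * J 2 q * J 6 q))) UNIV \<and>
    ((\<lambda>(i::nat, j::nat, k::nat).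
       q powi (2 * int i ^ 2 + int j ^ 2 + int k ^ 2 + 2 * int i * int j - 2 * int i * int k + int j)
       / (qpoch (q^2) (q^2) i * qpoch (q^2) (q^2) j * qpoch (q^2) (q^2) k))
     has_sum (J 2 q ^ 2 * J 3 q ^ 2 / (J 1 q ^ 2 * J 4 q * J 6 q))) UNIV \<and>
    ((\<lambda>(i::nat, j::nat, k::nat).
       q powi (2 * int i ^ 2 + int j ^ 2 + int k ^ 2 + 2 * int i * int j - 2 * int i * int k
               + 2 * int i + int j)
       / (qpoch (q^2) (q^2) i * qpoch (q^2) (q^2) j * qpoch (q^2) (q^2) k))
     has_sum (J 2 q * J 6 q ^ 2 / (J 1 q * J 3 q * J 4 q))) UNIV \<and>
    ((\<lambda>(i::nat, j::nat, k::nat).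
       q powi (2 * int i ^ 2 + int j ^ 2 + int k ^ 2 + 2 * int i * int j - 2 * int i * int k
               + 2 * int i + 2 * int j - int k)
       / (qpoch (q^2) (q^2) i * qpoch (q^2) (q^2) j * qpoch (q^2) (q^2) k))
     has_sum (2 * J 4 q * J 6 q ^ 2 / (J 2 q ^ 2 * J 3 q))) UNIV"
proof (cases "q = 0")
  case False
  with assms show ?thesis
    by (intro conjI triple_sum_identity1 triple_sum_identity2 triple_sum_identity3 triple_sum_identity4 triple_sum_identity5)
next
  case True
  \<comment> \<open>At q = 0 every denominator and every \<open>J m\<close> with m > 0 equals 1, so
    the right-hand sides are 6, 1, 1, 1, 2 and have to agree with the numbers of zeros of the
    exponents.\<close>
  have *: "((\<lambda>(i::nat, j::nat, k::nat). (0 :: complex) powi e i j k) has_sum of_nat (card B)) UNIV"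
    if "finite B" "\<And>i j k. e i j k = 0 \<longleftrightarrow> (i, j, k) \<in> B" for e B
    using has_sum_zero_powi[OF that(1), of "\<lambda>(i, j, k). e i j k"] that(2)
    by (simp add: case_prod_unfold)
  have **: "((\<lambda>(i::nat, j::nat, k::nat). (0 :: complex) powi
        (2 * int i ^ 2 + int j ^ 2 + int k ^ 2 + 2 * int i * int j - 2 * int i * int k + a i j k)) has_sum 1) UNIV"
    if "\<And>i j k. a i j k \<ge> 0" "a 0 0 0 = 0" for a
    using *[of "{(0, 0, 0)}" "\<lambda>i j k. 2 * int i ^ 2 + int j ^ 2 + int k ^ 2 + 2 * int i * int j - 2 * int i * int k + a i j k"]
      that exponent_zero_iff[OF that(1)] by auto
  show ?thesis
    unfolding True
    using *[OF _ exponent1_zero_iff] **[of "\<lambda>i j k. int k"] **[of "\<lambda>i j k. int j"]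
      **[of "\<lambda>i j k. 2 * int i + int j"] *[OF _ exponent5_zero_iff]
    by (simp add: J_zero add.assoc)
qed

end
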